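(* Let $c\in\mathbb C$ be a number that is not of the form $1-\frac{6(p-q)^2}{pq}$ with $p,q\ge2$ coprime integers. Let $V=L(c,0)$, let $W=M(c,1)$ with grading operator $\mathbf d_W=L(0)$, and let $w\in W$ be a nonzero lowest weight vector. Then the assignment $F(\omega)=L(-1)w$ extends to a well-defined derivation $F:V\to W$, i.e. an element of $H^1(V,W)$.
   Context: The Virasoro algebra is $\bigoplus_{n\in\mathbb Z}\mathbb CL_n\oplus\mathbb C\mathbf c$ with $\mathbf c$ central and $[L_m,L_n]=(m-n)L_{m+n}+\delta_{m+n,0}\frac{m^3-m}{12}\mathbf c$. $M(c,h)$ is the Verma module: it is induced from the one-dimensional $(\bigoplus_{n\ge0}\mathbb CL_n\oplus\mathbb C\mathbf c)$-module on which $L_n$ ($n>0$) acts by $0$, $L_0$ by $h$ and $\mathbf c$ by $c$. $V(c,0)$ is the quotient of $M(c,0)$ by the submodule generated by $L(-1)\mathbf 1$ ($\mathbf 1$ the lowest weight vector), with its standard VOA structure ($\omega=L(-2)\mathbf 1$), and $L(c,0)$ is its unique simple quotient VOA. For $c$ as in the claim $L(c,0)=V(c,0)$, and $M(c,1)$ is a $V$-module with $Y_W(\omega,x)=\sum_nL(n)x^{-n-2}$. For a vertex operator algebra $(V,Y,\mathbf 1,\omega)$ and a $V$-module $(W,Y_W)$ with grading operator $\mathbf d_W$, put $Y_{WV}^W(w,x)v=e^{xL(-1)}Y_W(v,-x)w$ for $w\in W$, $v\in V$. A (grading-preserving) derivation is a linear map $F:V\to W$ with $F\circ L(0)=\mathbf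 d_W\circ F$ and $F(Y(u,x)v)=Y_W(u,x)F(v)+Y_{WV}^W(F(u),x)v$ for all $u,v\in V$. $H^1(V,W)$ is (identified with) the space of all such derivations. *)

theory Defs
  imports Complex_Main "HOL-Library.Poly_Mapping"
begin

section \<open>Representations of the Virasoro algebra\<close>

text \<open>
  A representation of the Virasoro algebra on \<open>'m\<close> is given by the operators of the basis
  elements \<open>L\<^sub>n\<close> and \<open>\<^bold>c\<close>.
\<close>

record 'm vir_mod =
  mscale :: "complex \<Rightarrow> 'm \<Rightarrow> 'm"
  Lop :: "int \<Rightarrow> 'm \<Rightarrow> 'm"
  Cop :: "'m \<Rightarrow> 'm"

locale virasoro_rep =
  fixes M :: "'m::ab_group_add vir_mod"
  assumes vector_space: "vector_space (mscale M)"
    and linear_Lop: "Vector_Spaces.linear (mscale M) (mscale M) (Lop M n)"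
    and linear_Cop: "Vector_Spaces.linear (mscale M) (mscale M) (Cop M)"
    and Cop_central: "Lop M n (Cop M x) = Cop M (Lop M n x)"
    and Lop_bracket:
      "Lop M m (Lop M n x) - Lop M n (Lop M m x) =
         mscale M (of_int (m - n)) (Lop M (m + n) x)
         + (if m + n = 0 then mscale M (of_int (m ^ 3 - m) / 12) (Cop M x) else 0)"

definition vir_submodule :: "'m::ab_group_add vir_mod \<Rightarrow> 'm set \<Rightarrow> bool" where
  "vir_submodule M N \<longleftrightarrow>
     module.subspace (mscale M) N \<and> (\<forall>n. \<forall>x\<in>N. Lop M n x \<in> N) \<and> (\<forall>x\<in>N. Cop M x \<in> N)"

definition vir_submodule_generated :: "'m::ab_group_add vir_mod \<Rightarrow> 'm set \<Rightarrow> 'm set" where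
  "vir_submodule_generated M S = \<Inter>{N. vir_submodule M N \<and> S \<subseteq> N}"

definition vir_hom :: "'m::ab_group_add vir_mod \<Rightarrow> 'n::ab_group_add vir_mod \<Rightarrow> ('m \<Rightarrow> 'n) \<Rightarrow> bool" where
  "vir_hom M M' f \<longleftrightarrow>
     Vector_Spaces.linear (mscale M) (mscale M') f \<and>
     (\<forall>n x. f (Lop M n x) = Lop M' n (f x)) \<and> (\<forall>x. f (Cop M x) = Cop M' (f x))"

text \<open>\<open>M'\<close>, with projection \<open>p\<close>, is the quotient of \<open>M\<close> by the submodule \<open>N\<close>.\<close>

definition vir_quotient ::
    "'m::ab_group_add vir_mod \<Rightarrow> 'm set \<Rightarrow> 'n::ab_group_add vir_mod \<Rightarrow> ('m \<Rightarrow> 'n) \<Rightarrow> bool" where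
  "vir_quotient M N M' p \<longleftrightarrow>
     virasoro_rep M' \<and> vir_hom M M' p \<and> surj p \<and> (\<forall>x. p x = 0 \<longleftrightarrow> x \<in> N)"

definition lowest_weight_vector :: "complex \<Rightarrow> 'm::ab_group_add vir_mod \<Rightarrow> 'm \<Rightarrow> bool" where
  "lowest_weight_vector h M w \<longleftrightarrow>
     w \<noteq> 0 \<and> (\<forall>n>0. Lop M n w = 0) \<and> Lop M 0 w = mscale M h w"


section \<open>Verma modules\<close>

text \<open>
  The free associative algebra on the basis of the Virasoro algebra is the monoid algebra of the
  free monoid of words, whose multiplication is concatenation.
\<close>

datatype vir_gen = GL int | GC

instantiation list :: (type) monoid_add
begin
definition zero_list :: "'a list" where "zero_list = []"
definition plus_list :: "'a list \<Rightarrow> 'a list \<Rightarrow> 'a list" where "plus_list xs ys = xs @ ys"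
instance by standard (simp_all add: zero_list_def plus_list_def)
end

type_synonym vir_free = "vir_gen list \<Rightarrow>\<^sub>0 complex"

definition gen :: "vir_gen \<Rightarrow> vir_free" where
  "gen g = Poly_Mapping.single [g] 1"

definition const :: "complex \<Rightarrow> vir_free" where
  "const k = Poly_Mapping.single [] k"

text \<open>
  The universal enveloping algebra is the quotient of the free algebra by the two-sided ideal
  generated by the following elements.
\<close>

definition vir_relators :: "vir_free set" where
  "vir_relators =
     {gen (GL m) * gen (GL n) - gen (GL n) * gen (GL m) - const (of_int (m - n)) * gen (GL (m + n))
        - (if m + n = 0 then const (of_int (m ^ 3 - m) / 12) * gen GC else 0) | m n. True}
     \<union> {gen (GL n) * gen GC - gen GC * gen (GL n) | n. True}"

text \<open>
  Let \<open>\<bb>\<close> be spanned by \<open>\<^bold>c\<close> and the \<open>L\<^sub>n\<close> with \<open>n \<ge> 0\<close>, let \<open>\<lambda>\<close> be its character with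
  \<open>\<lambda>(L\<^sub>n) = 0\<close> for \<open>n > 0\<close>, \<open>\<lambda>(L\<^sub>0) = h\<close> and \<open>\<lambda>(\<^bold>c) = c\<close>, and let \<open>U\<close> denote universal enveloping
  algebras. The induced module \<open>U \<otimes> \<complex>\<^sub>\<lambda>\<close> (tensor product over \<open>U(\<bb>)\<close>) is \<open>U\<close> modulo the left
  ideal generated by all \<open>b - \<lambda>(b)\<close> with \<open>b \<in> \<bb>\<close>; \<open>verma_ideal c h\<close> is the preimage of that left
  ideal in the free algebra.
\<close>

inductive_set verma_ideal :: "complex \<Rightarrow> complex \<Rightarrow> vir_free set" for c h :: complex where
  zero: "0 \<in> verma_ideal c h"
| add: "a \<in> verma_ideal c h \<Longrightarrow> b \<in> verma_ideal c h \<Longrightarrow> a + b \<in> verma_ideal c h"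
| relator: "r \<in> vir_relators \<Longrightarrow> a * r * b \<in> verma_ideal c h"
| char_pos: "n > 0 \<Longrightarrow> a * gen (GL n) \<in> verma_ideal c h"
| char_zero: "a * (gen (GL 0) - const h) \<in> verma_ideal c h"
| char_central: "a * (gen GC - const c) \<in> verma_ideal c h"

fun gen_act :: "'m vir_mod \<Rightarrow> vir_gen \<Rightarrow> 'm \<Rightarrow> 'm" where
  "gen_act M (GL n) = Lop M n"
| "gen_act M GC = Cop M"

definition free_act :: "'m::ab_group_add vir_mod \<Rightarrow> vir_free \<Rightarrow> 'm \<Rightarrow> 'm" where
  "free_act M a x = (\<Sum>u\<in>Poly_Mapping.keys a. mscale M (Poly_Mapping.lookup a u) (foldr (gen_act M) u x))"

text \<open>
  \<open>M\<close> is the Verma module \<open>M(c,h)\<close> with \<open>v\<close> the image of \<open>1 \<otimes> 1\<close>, that is, \<open>a \<mapsto> a v\<close> induces an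
  isomorphism from the induced module onto \<open>M\<close>.
\<close>

definition verma_module :: "complex \<Rightarrow> complex \<Rightarrow> 'm::ab_group_add vir_mod \<Rightarrow> 'm \<Rightarrow> bool" where
  "verma_module c h M v \<longleftrightarrow>
     virasoro_rep M \<and> surj (\<lambda>a. free_act M a v) \<and>
     (\<forall>a. free_act M a v = 0 \<longleftrightarrow> a \<in> verma_ideal c h)"


section \<open>Vertex operator algebras and modules\<close>

text \<open>
  Vertex operators are given by their modes: \<open>Y u n\<close> is the operator \<open>u\<^sub>n\<close> in
  \<open>Y(u,x) = \<Sum>\<^sub>n u\<^sub>n x\<^bsup>-n-1\<^esup>\<close>.
\<close>

record 'v voa =
  vscale :: "complex \<Rightarrow> 'v \<Rightarrow> 'v"
  Y :: "'v \<Rightarrow> int \<Rightarrow> 'v \<Rightarrow> 'v"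
  vac :: 'v
  conf :: 'v

record ('v, 'w) voa_mod =
  wscale :: "complex \<Rightarrow> 'w \<Rightarrow> 'w"
  YW :: "'v \<Rightarrow> int \<Rightarrow> 'w \<Rightarrow> 'w"
  dW :: "'w \<Rightarrow> 'w"

definition LV :: "'v voa \<Rightarrow> int \<Rightarrow> 'v \<Rightarrow> 'v" where
  "LV V n = Y V (conf V) (n + 1)"

definition LW :: "'v voa \<Rightarrow> ('v, 'w) voa_mod \<Rightarrow> int \<Rightarrow> 'w \<Rightarrow> 'w" where
  "LW V W n = YW W (conf V) (n + 1)"

definition vir_of_voa :: "complex \<Rightarrow> 'v voa \<Rightarrow> 'v vir_mod" where
  "vir_of_voa c V = \<lparr>mscale = vscale V, Lop = LV V, Cop = vscale V c\<rparr>"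

definition vir_of_mod :: "complex \<Rightarrow> 'v voa \<Rightarrow> ('v, 'w) voa_mod \<Rightarrow> 'w vir_mod" where
  "vir_of_mod c V W = \<lparr>mscale = wscale W, Lop = LW V W, Cop = wscale W c\<rparr>"

text \<open>
  Vertex operators of \<open>V\<close> acting on a space with scalar multiplication \<open>s\<close>: \<open>Z u n\<close> is bilinear
  and lower truncated, and satisfies the Jacobi identity
  \<open>x\<^sub>0\<^bsup>-1\<^esup>\<delta>((x\<^sub>1-x\<^sub>2)/x\<^sub>0) Z(u,x\<^sub>1) Z(v,x\<^sub>2) - x\<^sub>0\<^bsup>-1\<^esup>\<delta>((x\<^sub>2-x\<^sub>1)/-x\<^sub>0) Z(v,x\<^sub>2) Z(u,x\<^sub>1)
     = x\<^sub>2\<^bsup>-1\<^esup>\<delta>((x\<^sub>1-x\<^sub>0)/x\<^sub>2) Z(Y(u,x\<^sub>0)v,x\<^sub>2)\<close>,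
  stated below as the equality of the coefficients of \<open>x\<^sub>0\<^bsup>-l-1\<^esup> x\<^sub>1\<^bsup>-m-1\<^esup> x\<^sub>2\<^bsup>-n-1\<^esup>\<close>. The sums over \<open>i\<close>
  have finite support by truncation.
\<close>

locale vertex_operators =
  fixes V :: "'v::ab_group_add voa"
    and s :: "complex \<Rightarrow> 'w::ab_group_add \<Rightarrow> 'w"
    and Z :: "'v \<Rightarrow> int \<Rightarrow> 'w \<Rightarrow> 'w"
  assumes vector_space_V: "vector_space (vscale V)"
    and vector_space_W: "vector_space s"
    and linear_left: "Vector_Spaces.linear (vscale V) s (\<lambda>u. Z u n x)"
    and linear_right: "Vector_Spaces.linear s s (Z u n)"
    and truncation: "\<exists>N. \<forall>n\<ge>N. Z u n x = 0"
    and identity: "Z (vac V) n x = (if n = -1 then x else 0)"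
    and jacobi:
      "Sum_any (\<lambda>i::nat. s ((of_int m :: complex) gchoose i)
                           (Z (Y V u (l + int i) v) (m + n - int i) x)) =
       Sum_any (\<lambda>i::nat. s ((- 1) ^ i * ((of_int l :: complex) gchoose i))
                           (Z u (m + l - int i) (Z v (n + int i) x)
                            - s ((- 1) powi l) (Z v (n + l - int i) (Z u (m + int i) x))))"
    and derivative: "Z (LV V (- 1) u) n x = s (- of_int n) (Z u (n - 1) x)"

definition eigenspace :: "(complex \<Rightarrow> 'w \<Rightarrow> 'w) \<Rightarrow> ('w \<Rightarrow> 'w) \<Rightarrow> complex \<Rightarrow> 'w set" where
  "eigenspace s d h = {x. d x = s h x}"

text \<open>
  The space is the direct sum of the eigenspaces of \<open>d\<close> (which are always independent); these are
  finite-dimensional and vanish when the real part of the weight is sufficiently negative.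
\<close>

definition graded_by :: "(complex \<Rightarrow> 'w::ab_group_add \<Rightarrow> 'w) \<Rightarrow> ('w \<Rightarrow> 'w) \<Rightarrow> bool" where
  "graded_by s d \<longleftrightarrow>
     Vector_Spaces.linear s s d \<and>
     module.span s (\<Union>h. eigenspace s d h) = UNIV \<and>
     (\<forall>h. \<exists>B. finite B \<and> eigenspace s d h \<subseteq> module.span s B) \<and>
     (\<exists>N::real. \<forall>h. Re h < N \<longrightarrow> eigenspace s d h = {0})"

locale vertex_operator_algebra =
  fixes c :: complex and V :: "'v::ab_group_add voa"
  assumes vertex_operators: "vertex_operators V (vscale V) (Y V)"
    and creation: "Y V u (- 1) (vac V) = u"
    and creation_regular: "n \<ge> 0 \<Longrightarrow> Y V u n (vac V) = 0"
    and virasoro: "virasoro_rep (vir_of_voa c V)"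
    and graded: "graded_by (vscale V) (LV V 0)"
    and integral_weights: "eigenspace (vscale V) (LV V 0) h \<noteq> {0} \<Longrightarrow> h \<in> \<int>"

text \<open>
  The last axiom is \<open>[d, Y\<^sub>W(v,x)] = Y\<^sub>W(L(0)v,x) + x (d/dx) Y\<^sub>W(v,x)\<close>, where the first \<open>d\<close> is the
  grading operator.
\<close>

locale voa_module =
  fixes c :: complex and V :: "'v::ab_group_add voa" and W :: "('v, 'w::ab_group_add) voa_mod"
  assumes voa: "vertex_operator_algebra c V"
    and vertex_operators: "vertex_operators V (wscale W) (YW W)"
    and virasoro: "virasoro_rep (vir_of_mod c V W)"
    and graded: "graded_by (wscale W) (dW W)"
    and dW_bracket:
      "dW W (YW W v n x) - YW W v n (dW W x) =
         YW W (LV V 0 v) n x + wscale W (of_int (- n - 1)) (YW W v n x)"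

definition voa_ideal :: "'v::ab_group_add voa \<Rightarrow> 'v set \<Rightarrow> bool" where
  "voa_ideal V I \<longleftrightarrow>
     module.subspace (vscale V) I \<and> (\<forall>v n. \<forall>x\<in>I. Y V v n x \<in> I \<and> Y V x n v \<in> I)"

definition simple_voa :: "'v::ab_group_add voa \<Rightarrow> bool" where
  "simple_voa V \<longleftrightarrow> (UNIV :: 'v set) \<noteq> {0} \<and> (\<forall>I. voa_ideal V I \<longrightarrow> I = {0} \<or> I = UNIV)"

definition voa_hom :: "'v::ab_group_add voa \<Rightarrow> 'u::ab_group_add voa \<Rightarrow> ('v \<Rightarrow> 'u) \<Rightarrow> bool" where
  "voa_hom V V' f \<longleftrightarrow>
     Vector_Spaces.linear (vscale V) (vscale V') f \<and>
     (\<forall>u n v. f (Y V u n v) = Y V' (f u) n (f v)) \<and> f (vac V) = vac V' \<and> f (conf V) = conf V'"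


section \<open>The Virasoro vertex operator algebras\<close>

text \<open>
  \<open>V\<close> is \<open>V(c,0)\<close> with its standard structure: as a representation it is the quotient, with
  projection \<open>p\<close>, of the Verma module \<open>M = M(c,0)\<close> with generator \<open>v\<close> by the submodule generated by
  \<open>L(-1)v\<close>, and its vertex operator algebra structure has vacuum \<open>p v\<close>, conformal vector
  \<open>L(-2)(p v)\<close> and \<open>Y(\<omega>,x) = \<Sum>\<^sub>n L(n) x\<^bsup>-n-2\<^esup>\<close> for the operators \<open>L(n)\<close> of the quotient
  representation, which \<open>vir_of_voa c V\<close> expresses. These data determine \<open>Y\<close>.
\<close>

definition universal_virasoro_voa ::
    "complex \<Rightarrow> 'm::ab_group_add vir_mod \<Rightarrow> 'm \<Rightarrow> 'v::ab_group_add voa \<Rightarrow> ('m \<Rightarrow> 'v) \<Rightarrow> bool" where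
  "universal_virasoro_voa c M v V p \<longleftrightarrow>
     verma_module c 0 M v \<and>
     vertex_operator_algebra c V \<and>
     vir_quotient M (vir_submodule_generated M {Lop M (- 1) v}) (vir_of_voa c V) p \<and>
     vac V = p v \<and> conf V = p (Lop M (- 2) v)"

definition simple_quotient_voa ::
    "complex \<Rightarrow> 'u::ab_group_add voa \<Rightarrow> 'v::ab_group_add voa \<Rightarrow> ('u \<Rightarrow> 'v) \<Rightarrow> bool" where
  "simple_quotient_voa c V0 V q \<longleftrightarrow>
     vertex_operator_algebra c V \<and> simple_voa V \<and> voa_hom V0 V q \<and> surj q"


section \<open>Derivations\<close>

text \<open>
  The coefficient of \<open>x\<^bsup>-n-1\<^esup>\<close> in \<open>e\<^bsup>xL(-1)\<^esup> Y\<^sub>W(v,-x)w\<close>; the sum has finite support by truncation.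
\<close>

definition YWV :: "'v::ab_group_add voa \<Rightarrow> ('v, 'w::ab_group_add) voa_mod \<Rightarrow> 'w \<Rightarrow> int \<Rightarrow> 'v \<Rightarrow> 'w" where
  "YWV V W w n v =
     Sum_any (\<lambda>i::nat. wscale W ((- 1) powi (n + int i + 1) / fact i)
                         ((LW V W (- 1) ^^ i) (YW W v (n + int i) w)))"

definition H1 :: "'v::ab_group_add voa \<Rightarrow> ('v, 'w::ab_group_add) voa_mod \<Rightarrow> ('v \<Rightarrow> 'w) set" where
  "H1 V W =
     {F. Vector_Spaces.linear (vscale V) (wscale W) F \<and>
         F \<circ> LV V 0 = dW W \<circ> F \<and>
         (\<forall>u n v. F (Y V u n v) = YW W u n (F v) + YWV V W (F u) n v)}"


section \<open>Minimal model central charges\<close>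

definition minimal_central_charge :: "complex \<Rightarrow> bool" where
  "minimal_central_charge c \<longleftrightarrow>
     (\<exists>p q :: int. p \<ge> 2 \<and> q \<ge> 2 \<and> coprime p q \<and>
        c = 1 - 6 * of_int ((p - q) ^ 2) / of_int (p * q))"

end

(*
  Skew symmetry turns the vertex operators of V on W into modes y_n : V -> W for y in W, and these
  obey both commutator formulas.  For the primary vector w of weight 1 they give
  [L(m), w_n] = -n w_(m+n), so that phi(L(m)) = -(m+1) w_m is a 1-cocycle and
  L(m)(v, x) = (L(m)v, L(m)x + phi(L(m))v) is a representation on V + W in which (1, 0) is killed by
  all L(m) with m >= -1.  F is the map whose graph is the submodule generated by (1, 0).

  The submodule is a graph because it is spanned by the monomials L(n_1)...L(n_k)(1, 0) with
  n_1 <= ... <= n_k <= -2, whose first components are linearly independent in V.  No Kac determinant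
  is needed for this: V acts on a Verma module W, and the coefficient (L(n_1)...L(n_k)1)_(-1) applied
  to the lowest weight vector has leading PBW term L(n_1)...L(n_k).

  The defect E(u)_n = F u_n - u_n F - F(u)_n of the derivation property satisfies
  [L(m), E(u)_n] = sum_j binom(m+1, j) E(L(j-1)u)_(m+1+n-j) and kills the vacuum, hence vanishes.
*)
theory Submission
  imports Defs "HOL-Library.Product_Plus"
    "HOL-Computational_Algebra.Formal_Power_Series"
begin

text \<open>The cocycle is forced: for u = omega the derivation property reads F(L(m)v) = L(m)F(v) +
  F(omega)_(m+1) v, and (L(-1)w)_(m+1) = -(m+1) w_m. With F(1) = 0 this fixes F on every monomial,
  and the only question is whether the relations between monomials in V are respected.

  No basis of V is given, so independence has to be detected on the Verma module W. Leading PBW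
  terms are read off there without the PBW theorem, by a linear map \<open>e\<close> into
  polynomials in variables x_n that sends the generator to 1 and turns L(n), for n < 0, into
  \<open>rho n\<close>. The adjoint action alone would kill 1; the added multiplication by n x_n
  creates the products of variables, at the price of a factor n for each L(n), which is nonzero. The
  central term of the bracket never meets \<open>rho\<close>, because two negative indices do not
  add up to 0. The work lies in showing that \<open>e\<close> is well defined on the module given by
  generators and relations.\<close>

section \<open>Linear extension from a basis\<close>

lemma poly_mapping_add_induct [case_names single add]:
  fixes a :: "'a \<Rightarrow>\<^sub>0 complex"
  assumes single: "\<And>u k. P (Poly_Mapping.single u k)"
    and add: "\<And>a b. P a \<Longrightarrow> P b \<Longrightarrow> P (a + b)"
  shows "P a"
proof (induction a rule: update_induct)
  case const
  show ?case using single[of undefined 0] by simp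
next
  case (update a u k)
  have "Poly_Mapping.update u k a = a + Poly_Mapping.single u k"
    using update(1)
    by (intro poly_mapping_eqI)
      (auto simp: lookup_update lookup_add lookup_single when_def in_keys_iff)
  with add[OF update(3) single] show ?case by simp
qed

text \<open>The common form of \<open>free_act\<close>, \<open>der\<close> and
  \<open>free_symb\<close>, so that linearity is proved once for all three.\<close>

definition lin_ext :: "(complex \<Rightarrow> 'b \<Rightarrow> 'b) \<Rightarrow> ('a \<Rightarrow> 'b::ab_group_add) \<Rightarrow> ('a \<Rightarrow>\<^sub>0 complex) \<Rightarrow> 'b" where
  "lin_ext s f a = (\<Sum>u\<in>Poly_Mapping.keys a. s (Poly_Mapping.lookup a u) (f u))"

lemma lin_ext_single:
  assumes "vector_space s"
  shows "lin_ext s f (Poly_Mapping.single u k) = s k (f u)"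
proof -
  interpret vector_space s by fact
  show ?thesis by (simp add: lin_ext_def)
qed

lemma lin_ext_superset:
  assumes "vector_space s" "finite S" "Poly_Mapping.keys a \<subseteq> S"
  shows "lin_ext s f a = (\<Sum>u\<in>S. s (Poly_Mapping.lookup a u) (f u))"
proof -
  interpret vector_space s by fact
  show ?thesis unfolding lin_ext_def
    using assms by (intro sum.mono_neutral_left) (auto simp: in_keys_iff)
qed

lemma lin_ext_add:
  assumes "vector_space s"
  shows "lin_ext s f (a + b) = lin_ext s f a + lin_ext s f b"
proof -
  interpret vector_space s by fact
  let ?S = "Poly_Mapping.keys a \<union> Poly_Mapping.keys b"
  note sup = lin_ext_superset[OF assms, of ?S _ f]
  show ?thesis
    using Poly_Mapping.keys_add[of a b]
    by (simp add: sup lookup_add scale_left_distrib sum.distrib)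
qed

lemma lin_ext_zero [simp]: "lin_ext s f 0 = 0"
  by (simp add: lin_ext_def)

lemma lin_ext_minus:
  assumes "vector_space s"
  shows "lin_ext s f (- a) = - lin_ext s f a"
  using lin_ext_add[OF assms, of f a "- a"] by (simp add: eq_neg_iff_add_eq_0 add.commute)

lemma lin_ext_diff:
  assumes "vector_space s"
  shows "lin_ext s f (a - b) = lin_ext s f a - lin_ext s f b"
  using lin_ext_add[OF assms, of f a "- b"] by (simp add: lin_ext_minus[OF assms])

text \<open>The index \<open>0\<close> is the unit monomial, which is the empty multiset for
  \<open>symb\<close> and the empty word for \<open>vir_free\<close>; the lemma serves both.\<close>

lemma lin_ext_const_mult:
  fixes a :: "'a::monoid_add \<Rightarrow>\<^sub>0 complex"
  assumes "vector_space s"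
  shows "lin_ext s f (Poly_Mapping.single 0 k * a) = s k (lin_ext s f a)"
proof -
  interpret vector_space s by fact
  show ?thesis
  proof (induction a rule: poly_mapping_add_induct)
    case (single u l)
    show ?case by (simp add: mult_single lin_ext_single[OF assms])
  next
    case (add a b)
    then show ?case by (simp add: distrib_left lin_ext_add[OF assms] scale_right_distrib)
  qed
qed

section \<open>Symbols\<close>

text \<open>Polynomials in variables x_n with n an integer: multisets are the monomials, and their
  addition makes the convolution product commutative.\<close>

type_synonym symb = "int multiset \<Rightarrow>\<^sub>0 complex"

definition Const :: "complex \<Rightarrow> symb" where
  "Const k = Poly_Mapping.single 0 k"

abbreviation symb_scale :: "complex \<Rightarrow> symb \<Rightarrow> symb" where
  "symb_scale k P \<equiv> Const k * P"

definition Var :: "int \<Rightarrow> symb" where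
  "Var n = Poly_Mapping.single {#n#} 1"

lemma Const_0 [simp]: "Const 0 = 0"
  and Const_1 [simp]: "Const 1 = 1"
  and Const_add: "Const (k + l) = Const k + Const l"
  and Const_diff: "Const (k - l) = Const k - Const l"
  and Const_mult: "Const (k * l) = Const k * Const l"
  and Const_mult_single: "Const k * Poly_Mapping.single M l = Poly_Mapping.single M (k * l)"
  by (simp_all add: Const_def single_add single_diff mult_single)

lemma single_eq_Const_mult: "Poly_Mapping.single M k = Const k * Poly_Mapping.single M 1"
  by (simp add: Const_mult_single)

lemma vector_space_symb: "vector_space symb_scale"
  by unfold_locales
    (simp_all add: distrib_left distrib_right Const_add Const_mult mult.assoc)

text \<open>Leibniz rule for the derivation sending x_n to (m - n) x_(m+n), the adjoint action of
  the centreless algebra on its symmetric algebra.\<close>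

definition derM :: "int \<Rightarrow> int multiset \<Rightarrow> symb" where
  "derM m M = (\<Sum>n\<in>#M. Poly_Mapping.single (add_mset (m + n) (M - {#n#})) (of_int (m - n)))"

definition der :: "int \<Rightarrow> symb \<Rightarrow> symb" where
  "der m = lin_ext symb_scale (derM m)"

lemma der_add: "der m (P + Q) = der m P + der m Q"
  and der_zero [simp]: "der m 0 = 0"
  and der_diff: "der m (P - Q) = der m P - der m Q"
  and der_Const: "der m (Const k * P) = Const k * der m P"
  and der_single: "der m (Poly_Mapping.single M k) = Const k * derM m M"
  using lin_ext_const_mult[OF vector_space_symb, of "derM m" k P]
  by (simp_all add: der_def lin_ext_add[OF vector_space_symb] lin_ext_diff[OF vector_space_symb]
      lin_ext_single[OF vector_space_symb] flip: Const_def)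

lemma der_1 [simp]: "der m 1 = 0"
  using der_single[of m "{#}" 1] by (simp add: derM_def)

lemma derM_add_mset:
  "derM m (add_mset l M) = Const (of_int (m - l)) * Var (m + l) * Poly_Mapping.single M 1 + Var l * derM m M"
proof -
  have "(\<Sum>n\<in>#M. Poly_Mapping.single (add_mset (m + n) (add_mset l M - {#n#})) (of_int (m - n) :: complex))
      = (\<Sum>n\<in>#M. Var l * Poly_Mapping.single (add_mset (m + n) (M - {#n#})) (of_int (m - n)))"
    by (intro arg_cong[of _ _ sum_mset] image_mset_cong)
      (auto simp: Var_def mult_single multi_member_this)
  also have "\<dots> = Var l * derM m M"
    by (simp add: derM_def sum_mset_distrib_left)
  finally show ?thesis
    by (simp add: derM_def Var_def mult_single Const_mult_single)
qed

lemma der_Var_mult: "der m (Var l * P) = Const (of_int (m - l)) * Var (m + l) * P + Var l * der m P"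
proof (induction P rule: poly_mapping_add_induct)
  case (single M k)
  have "Var l * Poly_Mapping.single M k = Poly_Mapping.single (add_mset l M) k"
    by (simp add: Var_def mult_single)
  then show ?case
    by (simp add: der_single derM_add_mset) (simp add: single_eq_Const_mult[of M k] algebra_simps)
next
  case (add P Q)
  then show ?case by (simp add: distrib_left der_add)
qed

text \<open>A commutator of derivations is a derivation, so the claim reduces to single variables,
  where it is the Jacobi identity \<open>C\<close>. The induction on the monomial carries this
  out.\<close>

lemma der_commutator:
  "der m (der n P) - der n (der m P) = Const (of_int (m - n)) * der (m + n) P"
proof (induction P rule: poly_mapping_add_induct)
  case (single M k)
  have 1: "der m (der n (Poly_Mapping.single M 1)) - der n (der m (Poly_Mapping.single M 1))
    = Const (of_int (m - n)) * der (m + n) (Poly_Mapping.single M 1)"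
  proof (induction M)
    case empty
    show ?case by simp
  next
    case (add l M)
    let ?P = "Poly_Mapping.single M 1 :: symb"
    have eq: "Poly_Mapping.single (add_mset l M) 1 = Var l * ?P"
      by (simp add: Var_def mult_single)
    have C: "Const (of_int (n - l)) * (Const (of_int (m - (n + l))) * Z)
       - Const (of_int (m - l)) * (Const (of_int (n - (m + l))) * Z)
       = Const (of_int (m - n)) * (Const (of_int (m + n - l)) * Z)" for Z
    proof -
      have "Const (of_int (n - l)) * (Const (of_int (m - (n + l))) * Z)
       - Const (of_int (m - l)) * (Const (of_int (n - (m + l))) * Z)
       = Const (of_int (n - l) * of_int (m - (n + l)) - of_int (m - l) * of_int (n - (m + l))) * Z"
        by (simp only: Const_diff Const_mult left_diff_distrib mult.assoc)
      also have "of_int (n - l) * of_int (m - (n + l)) - of_int (m - l) * of_int (n - (m + l))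
        = (of_int (m - n) * of_int (m + n - l) :: complex)"
        by (simp add: algebra_simps)
      finally show ?thesis by (simp add: Const_mult mult.assoc)
    qed
    have "der m (der n (Var l * ?P)) - der n (der m (Var l * ?P))
      = Const (of_int (n - l)) * (Const (of_int (m - (n + l))) * (Var (m + n + l) * ?P))
       - Const (of_int (m - l)) * (Const (of_int (n - (m + l))) * (Var (m + n + l) * ?P))
       + Var l * (der m (der n ?P) - der n (der m ?P))"
      by (simp add: der_Var_mult der_add der_Const mult.assoc add_ac del: of_int_diff of_int_add)
        (simp add: algebra_simps)
    also have "\<dots> = Const (of_int (m - n)) * der (m + n) (Var l * ?P)"
      unfolding C add by (simp add: der_Var_mult distrib_left mult.left_commute mult.assoc)
    finally show ?case unfolding eq .
  qed
  show ?case
    using arg_cong[OF 1, of "\<lambda>x. Const k * x"]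
    unfolding single_eq_Const_mult[of M k]
    by (simp add: der_Const right_diff_distrib mult.left_commute)
next
  case (add P Q)
  then show ?case by (simp add: distrib_left der_add algebra_simps)
qed

text \<open>
  The map \<open>n \<mapsto> n x\<^sub>n\<close> is the coboundary of the grading derivation, hence a cocycle, so adding it
  to the adjoint action gives another representation \<open>rho\<close> of the centreless algebra. The leading
  term of \<open>rho n\<^sub>1 (\<dots> (rho n\<^sub>k 1))\<close> is the product of the \<open>n x\<^sub>n\<close> for \<open>n = n\<^sub>1, \<dots>, n\<^sub>k\<close>.
\<close>

definition rho :: "int \<Rightarrow> symb \<Rightarrow> symb" where
  "rho m P = der m P + Const (of_int m) * (Var m * P)"

lemma rho_add: "rho m (P + Q) = rho m P + rho m Q"
  and rho_zero [simp]: "rho m 0 = 0"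
  and rho_diff: "rho m (P - Q) = rho m P - rho m Q"
  and rho_Const: "rho m (Const k * P) = Const k * rho m P"
  by (simp_all add: rho_def der_add der_diff der_Const distrib_left right_diff_distrib mult.left_commute)

lemma rho_commutator:
  "rho m (rho n P) - rho n (rho m P) = Const (of_int (m - n)) * rho (m + n) P"
proof -
  let ?c = "\<lambda>i. Const (of_int i)"
  have c: "?c (i - j) = ?c i - ?c j" "?c (i + j) = ?c i + ?c j" for i j
    by (simp_all add: Const_diff Const_add)
  \<comment> \<open>The terms quadratic in the x's and the terms x_n \<open>der m\<close> P cancel.
    What is left is n(m-n) - m(n-m) = (m-n)(m+n), the cocycle identity for n x_n.\<close>
  have "rho m (rho n P) - rho n (rho m P) = (der m (der n P) - der n (der m P))
    + (?c n * (?c (m - n) * Var (m + n) * P) - ?c m * (?c (n - m) * Var (n + m) * P))"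
    by (simp add: rho_def der_add der_Const der_Var_mult c del: of_int_diff of_int_add)
      (simp add: algebra_simps)
  also have "\<dots> = ?c (m - n) * rho (m + n) P"
    by (simp add: der_commutator rho_def c add.commute[of n m] del: of_int_diff of_int_add)
      (simp add: algebra_simps)
  finally show ?thesis .
qed

section \<open>The symbol map on a Verma module\<close>

text \<open>The value at the commutator [L_m, g] of the linear extension of h. Brackets occur only
  through such values, so no type of Lie algebra elements is introduced.\<close>

fun bracket :: "int \<Rightarrow> vir_gen \<Rightarrow> (vir_gen \<Rightarrow> symb) \<Rightarrow> symb" where
  "bracket m (GL n) h = Const (of_int (m - n)) * h (GL (m + n))
     + (if m + n = 0 then Const (of_int (m ^ 3 - m) / 12) * h GC else 0)"
| "bracket m GC h = 0"

text \<open>The value of f at [L_m, u], with the commutator expanded by the Leibniz rule over the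
  letters of u.\<close>

primrec bracket_word :: "int \<Rightarrow> (vir_gen list \<Rightarrow> symb) \<Rightarrow> vir_gen list \<Rightarrow> symb" where
  "bracket_word m f [] = 0"
| "bracket_word m f (g # u) = bracket m g (\<lambda>g'. f (g' # u)) + bracket_word m (\<lambda>t. f (g # t)) u"

lemma bracket_add: "bracket m g (\<lambda>x. h x + h' x) = bracket m g h + bracket m g h'"
  by (cases g) (simp_all add: distrib_left)

lemma bracket_diff: "bracket m g (\<lambda>x. h x - h' x) = bracket m g h - bracket m g h'"
  by (cases g) (simp_all add: right_diff_distrib)

lemma bracket_mult: "bracket m g (\<lambda>x. P * h x) = P * bracket m g h"
  by (cases g) (simp_all add: distrib_left mult.left_commute)

lemma bracket_rho: "bracket m g (\<lambda>x. rho n (h x)) = rho n (bracket m g h)"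
  by (cases g) (simp_all add: rho_add rho_Const)

lemma bracket_zero [simp]: "bracket m g (\<lambda>x. 0) = 0"
  by (cases g) simp_all

lemma bracket_antisym: "bracket a (GL b) h = - bracket b (GL a) h"
proof -
  have "Const (of_int (a - b)) = - Const (of_int (b - a))"
    by (simp add: Const_diff)
  moreover have "Const (of_int (a ^ 3 - a) / 12) = - Const (of_int (b ^ 3 - b) / 12)" if "a + b = 0"
  proof -
    from that have b: "b = - a" by simp
    have "Const (of_int (a ^ 3 - a) / 12) + Const (of_int (b ^ 3 - b) / 12)
      = Const (of_int (a ^ 3 - a) / 12 + of_int (b ^ 3 - b) / 12)"
      by (simp add: Const_add)
    also have "of_int (a ^ 3 - a) / 12 + of_int (b ^ 3 - b) / 12 = (0 :: complex)"
      unfolding b by (simp add: field_simps)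
    finally show ?thesis by (simp add: eq_neg_iff_add_eq_0)
  qed
  ultimately show ?thesis by (auto simp: add.commute simp del: of_int_diff)
qed

text \<open>Jacobi identity for L_m, L_a, L_b. The coefficient of L_(m+a+b) is fact
  \<open>1\<close>; that of the central letter is fact \<open>2\<close>, the 2-cocycle identity of
  m^3 - m.\<close>

lemma bracket_jacobi:
  "Const (of_int (m - a)) * bracket (m + a) (GL b) h + Const (of_int (m - b)) * bracket a (GL (m + b)) h
   = Const (of_int (a - b)) * bracket m (GL (a + b)) h"
proof -
  let ?X = "h (GL (m + a + b))" and ?Y = "h GC"
  have lin: "Const p * (Const q * X + Const r * Y) = Const (p * q) * X + Const (p * r) * Y" for p q r X Y
    by (simp add: Const_mult algebra_simps)
  have br: "bracket k (GL n) h = Const (of_int (k - n)) * ?X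
      + Const (if m + a + b = 0 then of_int (k ^ 3 - k) / 12 else 0) * ?Y" if "k + n = m + a + b" for k n
    using that by auto
  have 1: "of_int (m - a) * of_int (m + a - b) + of_int (m - b) * of_int (a - (m + b))
     = (of_int (a - b) * of_int (m - (a + b)) :: complex)"
    by (simp add: algebra_simps)
  have 2: "of_int (m - a) * (if m + a + b = 0 then of_int ((m + a) ^ 3 - (m + a)) / 12 else 0)
     + of_int (m - b) * (if m + a + b = 0 then of_int (a ^ 3 - a) / 12 else 0)
     = (of_int (a - b) * (if m + a + b = 0 then of_int (m ^ 3 - m) / 12 else 0) :: complex)"
  proof (cases "m + a + b = 0")
    case True
    then have b: "b = - m - a" by simp
    have "(m - a) * ((m + a) ^ 3 - (m + a)) + (m - b) * (a ^ 3 - a) = (a - b) * (m ^ 3 - m)"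
      unfolding b by (simp add: algebra_simps power3_eq_cube)
    then have "of_int ((m - a) * ((m + a) ^ 3 - (m + a)) + (m - b) * (a ^ 3 - a))
        = (of_int ((a - b) * (m ^ 3 - m)) :: complex)" by simp
    then show ?thesis using True by (simp add: add_divide_distrib[symmetric])
  qed simp
  have e: "bracket (m + a) (GL b) h = Const (of_int (m + a - b)) * ?X
      + Const (if m + a + b = 0 then of_int ((m + a) ^ 3 - (m + a)) / 12 else 0) * ?Y"
    "bracket a (GL (m + b)) h = Const (of_int (a - (m + b))) * ?X
      + Const (if m + a + b = 0 then of_int (a ^ 3 - a) / 12 else 0) * ?Y"
    "bracket m (GL (a + b)) h = Const (of_int (m - (a + b))) * ?X
      + Const (if m + a + b = 0 then of_int (m ^ 3 - m) / 12 else 0) * ?Y"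
    by (intro br; simp)+
  show ?thesis
    unfolding e lin 1[symmetric] 2[symmetric] Const_add distrib_right by (simp only: add_ac)
qed

lemma bracket_bracket_GL:
  "bracket a (GL n) (\<lambda>x. bracket b x h) = Const (of_int (a - n)) * bracket b (GL (a + n)) h"
  by simp

text \<open>The left side evaluates h at [L_b,[L_a,g]] - [L_a,[L_b,g]]: acting on functions reverses
  the order of composition, whence b - a instead of a - b.\<close>

lemma bracket_bracket:
  "bracket a g (\<lambda>x. bracket b x h) - bracket b g (\<lambda>x. bracket a x h)
   = Const (of_int (b - a)) * bracket (a + b) g h"
proof (cases g)
  case (GL n)
  show ?thesis
    using bracket_jacobi[of b a n h] unfolding GL bracket_bracket_GL
    by (simp add: add.commute[of b a] diff_eq_eq del: bracket.simps of_int_diff)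
qed simp

text \<open>A bracket replaces one letter by one letter, so f is evaluated only at words as long as
  u. This lets inductions on the length reach inside \<open>bracket_word\<close>.\<close>

lemma bracket_word_cong:
  assumes "\<And>t. length t = length u \<Longrightarrow> f t = f' t"
  shows "bracket_word m f u = bracket_word m f' u"
  using assms
proof (induction u arbitrary: f f')
  case (Cons g u)
  have "bracket m g (\<lambda>g'. f (g' # u)) = bracket m g (\<lambda>g'. f' (g' # u))"
    using Cons.prems by (intro arg_cong[of _ _ "bracket m g"] ext) simp
  moreover have "bracket_word m (\<lambda>t. f (g # t)) u = bracket_word m (\<lambda>t. f' (g # t)) u"
    using Cons.prems by (intro Cons.IH) simp
  ultimately show ?case by simp
qed simp

lemma bracket_word_append:
  "bracket_word m f (u @ v) = bracket_word m (\<lambda>t. f (t @ v)) u + bracket_word m (\<lambda>t. f (u @ t)) v"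
  by (induction u arbitrary: f) simp_all

lemma bracket_word_add:
  "bracket_word m (\<lambda>x. f x + f' x) u = bracket_word m f u + bracket_word m f' u"
  by (induction u arbitrary: f f') (simp_all add: bracket_add)

lemma bracket_word_diff:
  "bracket_word m (\<lambda>x. f x - f' x) u = bracket_word m f u - bracket_word m f' u"
  by (induction u arbitrary: f f') (simp_all add: bracket_diff)

lemma bracket_word_mult: "bracket_word m (\<lambda>x. P * f x) u = P * bracket_word m f u"
  by (induction u arbitrary: f) (simp_all add: bracket_mult distrib_left)

lemma bracket_word_rho: "bracket_word m (\<lambda>x. rho n (f x)) u = rho n (bracket_word m f u)"
  by (induction u arbitrary: f) (simp_all add: bracket_rho rho_add)

lemma bracket_word_zero [simp]: "bracket_word m (\<lambda>x. 0) u = 0"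
  by (induction u) simp_all

lemma bracket_word_bracket:
  "bracket_word m (\<lambda>t. bracket n g (\<lambda>x. f x t)) u = bracket n g (\<lambda>x. bracket_word m (f x) u)"
  by (cases g) (simp_all add: bracket_word_add bracket_word_mult)

text \<open>The terms in which the two brackets hit different letters are symmetric in a and b and
  cancel; those hitting the same letter are covered by \<open>bracket_bracket\<close>.\<close>

lemma bracket_word_commutator:
  "bracket_word a (bracket_word b f) u - bracket_word b (bracket_word a f) u
   = Const (of_int (b - a)) * bracket_word (a + b) f u"
proof (induction u arbitrary: f)
  case (Cons g u)
  have 1: "bracket_word a (bracket_word b f) (g # u) = bracket a g (\<lambda>x. bracket b x (\<lambda>y. f (y # u)))
    + bracket a g (\<lambda>x. bracket_word b (\<lambda>t. f (x # t)) u)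
    + bracket b g (\<lambda>x. bracket_word a (\<lambda>t. f (x # t)) u)
    + bracket_word a (bracket_word b (\<lambda>t. f (g # t))) u" for a b
    by (simp add: bracket_add bracket_word_add bracket_word_bracket)
  show ?case
    unfolding 1 using Cons.IH[of "\<lambda>t. f (g # t)"] bracket_bracket[of a g b "\<lambda>y. f (y # u)"]
    by (simp add: distrib_left algebra_simps del: of_int_diff)
qed simp

text \<open>
  The letters \<open>L\<^sub>m\<close> with \<open>m < 0\<close> act by \<open>rho\<close>; those with \<open>m \<ge> 0\<close> are commuted to the right end of
  the word, where the lowest weight vector turns them into scalars. Commuting never lengthens the
  rest of the word, so the recursion is on the length.
\<close>

primrec symb_aux :: "complex \<Rightarrow> complex \<Rightarrow> nat \<Rightarrow> vir_gen list \<Rightarrow> symb" where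
  "symb_aux c h 0 u = 1"
| "symb_aux c h (Suc k) u =
    (case u of [] \<Rightarrow> 1
     | g # t \<Rightarrow> (case g of GC \<Rightarrow> Const c * symb_aux c h k t
        | GL m \<Rightarrow> if m < 0 then rho m (symb_aux c h k t)
                  else Const (if m = 0 then h else 0) * symb_aux c h k t
                       + bracket_word m (symb_aux c h k) t))"

definition word_symb :: "complex \<Rightarrow> complex \<Rightarrow> vir_gen list \<Rightarrow> symb" where
  "word_symb c h u = symb_aux c h (length u) u"

section \<open>Relations between the symbols of words\<close>

context fixes c h :: complex
begin

private abbreviation "S \<equiv> word_symb c h"
private abbreviation "lam m \<equiv> Const (if m = (0::int) then h else 0)"

lemma word_symb_Nil [simp]: "S [] = 1"
  and word_symb_GC [simp]: "S (GC # u) = Const c * S u"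
  and word_symb_neg: "m < 0 \<Longrightarrow> S (GL m # u) = rho m (S u)"
  by (simp_all add: word_symb_def)

text \<open>The counter of \<open>symb_aux\<close> agrees with the length of every word that the
  bracket produces, so it disappears from the recursion.\<close>

lemma word_symb_nonneg:
  assumes "m \<ge> 0"
  shows "S (GL m # u) = lam m * S u + bracket_word m S u"
proof -
  have "bracket_word m (symb_aux c h (length u)) u = bracket_word m S u"
    by (intro bracket_word_cong) (simp add: word_symb_def)
  then show ?thesis using assms by (simp add: word_symb_def)
qed

text \<open>The induction is on the length and not on the list, because moving L_m to the right
  replaces the tail by other words of the same length.\<close>

lemma word_symb_central: "S (u @ GC # v) = Const c * S (u @ v)"
proof (induction "length u" arbitrary: u v)
  case (Suc k)
  then obtain g u' where u: "u = g # u'" and len: "length u' = k" by (cases u) auto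
  have IH: "S (t @ GC # v) = Const c * S (t @ v)" if "length t = length u'" for t v
    using Suc.hyps(1)[of t v] that len by simp
  show ?case
  proof (cases g)
    case (GL m)
    show ?thesis
    proof (cases "m < 0")
      case True
      then show ?thesis by (simp add: u GL word_symb_neg IH rho_Const)
    next
      case False
      have "bracket_word m (\<lambda>t. S (t @ GC # v)) u' = Const c * bracket_word m (\<lambda>t. S (t @ v)) u'"
        unfolding bracket_word_mult[symmetric] by (intro bracket_word_cong IH)
      then have "bracket_word m S (u' @ GC # v) = Const c * bracket_word m S (u' @ v)"
        by (simp add: bracket_word_append IH bracket_word_mult distrib_left)
      with False show ?thesis by (simp add: u GL word_symb_nonneg IH algebra_simps)
    qed
  next
    case GC
    then show ?thesis by (simp add: u IH)
  qed
qed simp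

text \<open>For mixed signs the bracket is exactly what the recursion produces when the nonnegative
  letter passes the negative one; for two negative letters it is
  \<open>rho_commutator\<close>.\<close>

lemma word_symb_commutator_Nil:
  "S (GL a # GL b # v) - S (GL b # GL a # v) = bracket a (GL b) (\<lambda>g. S (g # v))"
proof -
  have mixed: "S (GL a # GL b # v) - S (GL b # GL a # v) = bracket a (GL b) (\<lambda>g. S (g # v))"
    if "a \<ge> 0" "b < 0" for a b
  proof -
    have "bracket_word a (\<lambda>t. S (GL b # t)) v = rho b (bracket_word a S v)"
      using that by (simp add: word_symb_neg bracket_word_rho)
    then show ?thesis
      using that by (simp add: word_symb_nonneg word_symb_neg rho_add rho_Const del: bracket.simps)
  qed
  consider "a \<ge> 0" "b < 0" | "a < 0" "b \<ge> 0" | "a < 0" "b < 0" | "a \<ge> 0" "b \<ge> 0" by linarith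
  then show ?thesis
  proof cases
    case 1
    then show ?thesis by (rule mixed)
  next
    case 2
    then show ?thesis
      using mixed[of b a] bracket_antisym[of a b "\<lambda>g. S (g # v)"] by (simp add: algebra_simps)
  next
    case 3
    then show ?thesis by (simp add: word_symb_neg rho_commutator)
  next
    case 4
    \<comment> \<open>The character is zero on brackets of nonnegative modes: a + b > 0 leaves
      neither a scalar nor a central term, and for a = b = 0 both sides vanish.\<close>
    have br: "bracket b (GL a) (\<lambda>g. S (g # v)) = Const (of_int (b - a)) * bracket_word (a + b) S v"
    proof (cases "a = 0 \<and> b = 0")
      case False
      with 4 have "a + b \<noteq> 0" by linarith
      with 4 show ?thesis by (simp add: word_symb_nonneg add.commute[of b a])
    qed simp
    \<comment> \<open>The last parenthesis is symmetric in a and b and drops out of the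
      difference.\<close>
    have exp: "S (GL a # GL b # v) = bracket a (GL b) (\<lambda>g. S (g # v))
      + bracket_word a (bracket_word b S) v
      + (lam a * lam b * S v + lam a * bracket_word b S v + lam b * bracket_word a S v)"
      if "a \<ge> 0" "b \<ge> 0" for a b
    proof -
      have "bracket_word a (\<lambda>t. S (GL b # t)) v
          = lam b * bracket_word a S v + bracket_word a (bracket_word b S) v"
        using that by (simp add: word_symb_nonneg bracket_word_add bracket_word_mult)
      then show ?thesis
        using that by (simp add: word_symb_nonneg algebra_simps del: bracket.simps)
    qed
    show ?thesis
      using exp[of a b] exp[of b a] bracket_word_commutator[of a b S v] br 4
      by (simp add: algebra_simps del: bracket.simps)
  qed
qed

text \<open>Induction peels letters off u. A letter L_m with m >= 0 is commuted through the whole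
  word: its brackets with u' and v fall under the induction hypothesis, and those with the swapped
  pair combine by the Jacobi identity.\<close>

lemma word_symb_commutator:
  "S (u @ GL a # GL b # v) - S (u @ GL b # GL a # v) = bracket a (GL b) (\<lambda>g. S (u @ g # v))"
proof (induction "length u" arbitrary: u a b v)
  case 0
  then show ?case using word_symb_commutator_Nil by simp
next
  case (Suc k)
  then obtain g u' where u: "u = g # u'" and len: "length u' = k" by (cases u) auto
  have IH: "S (t @ GL a # GL b # v) - S (t @ GL b # GL a # v) = bracket a (GL b) (\<lambda>g. S (t @ g # v))"
    if "length t = length u'" for t a b v
    using Suc.hyps(1)[of t a b v] that len by simp
  show ?case
  proof (cases g)
    case GC
    then show ?thesis
      using IH[OF refl, of a b v] by (simp add: u bracket_mult right_diff_distrib[symmetric] del: bracket.simps)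
  next
    case (GL m)
    show ?thesis
    proof (cases "m < 0")
      case True
      then show ?thesis
        using IH[OF refl, of a b v]
        by (simp add: u GL word_symb_neg bracket_rho rho_diff[symmetric] del: bracket.simps)
    next
      case False
      let ?H = "\<lambda>g. S (u' @ g # v)"
      have 1: "bracket_word m (\<lambda>t. S (t @ GL a # GL b # v)) u' - bracket_word m (\<lambda>t. S (t @ GL b # GL a # v)) u'
        = bracket a (GL b) (\<lambda>g. bracket_word m (\<lambda>t. S (t @ g # v)) u')"
        unfolding bracket_word_bracket[symmetric] bracket_word_diff[symmetric]
        by (intro bracket_word_cong IH)
      have 2: "bracket_word m (\<lambda>t. S (u' @ GL a # GL b # t)) v - bracket_word m (\<lambda>t. S (u' @ GL b # GL a # t)) v
        = bracket a (GL b) (\<lambda>g. bracket_word m (\<lambda>t. S (u' @ g # t)) v)"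
        unfolding bracket_word_bracket[symmetric] bracket_word_diff[symmetric]
        by (intro bracket_word_cong IH) simp
      \<comment> \<open>The bracket hits one letter of the pair. The induction hypothesis swaps
        L_(m+a) with L_b, and a central letter can be pulled out on either side of L_b.\<close>
      have 3: "bracket m (GL a) (\<lambda>g. S (u' @ g # GL b # v)) - bracket m (GL a) (\<lambda>g. S (u' @ GL b # g # v))
        = Const (of_int (m - a)) * bracket (m + a) (GL b) ?H" for a b
        unfolding bracket_diff[symmetric]
        using word_symb_central[of u' "GL b # v"] word_symb_central[of "u' @ [GL b]" v]
        by (simp add: IH[OF refl] del: of_int_diff bracket.simps(2))
      have 4: "Const (of_int (m - a)) * bracket (m + a) (GL b) ?H - Const (of_int (m - b)) * bracket (m + b) (GL a) ?H
        = bracket a (GL b) (\<lambda>g. bracket m g ?H)"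
        using bracket_jacobi[of m a b ?H] bracket_antisym[of a "m + b" ?H]
        unfolding bracket_bracket_GL by (simp del: bracket.simps of_int_diff)
      have exp: "bracket_word m S (u' @ GL a # GL b # v)
        = bracket_word m (\<lambda>t. S (t @ GL a # GL b # v)) u'
          + bracket m (GL a) (\<lambda>g. S (u' @ g # GL b # v))
          + bracket m (GL b) (\<lambda>g. S (u' @ GL a # g # v))
          + bracket_word m (\<lambda>t. S (u' @ GL a # GL b # t)) v" for a b
        by (simp add: bracket_word_append add.assoc del: bracket.simps)
      have exp2: "bracket_word m S (u' @ g # v)
        = bracket_word m (\<lambda>t. S (t @ g # v)) u' + bracket m g ?H + bracket_word m (\<lambda>t. S (u' @ g # t)) v" for g
        by (simp add: bracket_word_append add.assoc del: bracket.simps)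
      have "bracket_word m S (u' @ GL a # GL b # v) - bracket_word m S (u' @ GL b # GL a # v)
        = bracket a (GL b) (\<lambda>g. bracket_word m S (u' @ g # v))"
        unfolding exp exp2 bracket_add
        using 1 2 3[of a b] 3[of b a] 4 by (simp add: algebra_simps del: bracket.simps)
      then show ?thesis
        using False IH[OF refl, of a b v]
        by (simp add: u GL word_symb_nonneg bracket_add bracket_mult algebra_simps del: bracket.simps)
    qed
  qed
qed

end

section \<open>Vanishing of the symbol map on the Verma ideal\<close>

definition free_symb :: "complex \<Rightarrow> complex \<Rightarrow> vir_free \<Rightarrow> symb" where
  "free_symb c h = lin_ext symb_scale (word_symb c h)"

lemma free_symb_add: "free_symb c h (a + b) = free_symb c h a + free_symb c h b"
  and free_symb_diff: "free_symb c h (a - b) = free_symb c h a - free_symb c h b"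
  and free_symb_zero [simp]: "free_symb c h 0 = 0"
  and free_symb_single: "free_symb c h (Poly_Mapping.single u k) = Const k * word_symb c h u"
  by (simp_all add: free_symb_def lin_ext_add[OF vector_space_symb] lin_ext_diff[OF vector_space_symb]
      lin_ext_single[OF vector_space_symb])

lemma single_mult_gen:
  "Poly_Mapping.single u k * gen g = Poly_Mapping.single (u @ [g]) k"
  "Poly_Mapping.single u k * const l = Poly_Mapping.single u (k * l)"
  by (simp_all add: gen_def const_def mult_single plus_list_def)

lemma free_symb_relator:
  assumes "r \<in> vir_relators"
  shows "free_symb c h (a * r * b) = 0"
proof -
  have words: "free_symb c h (Poly_Mapping.single u k * r * Poly_Mapping.single v l) = 0" for u k v l
  proof -
    let ?U = "Poly_Mapping.single u k" and ?V = "Poly_Mapping.single v l"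
    have three: "free_symb c h (?U * (p * q) * ?V) = free_symb c h (?U * p * q * ?V)" for p q
      by (simp add: mult.assoc)
    from assms consider (L) m n where "r = gen (GL m) * gen (GL n) - gen (GL n) * gen (GL m)
        - const (of_int (m - n)) * gen (GL (m + n))
        - (if m + n = 0 then const (of_int (m ^ 3 - m) / 12) * gen GC else 0)"
      | (C) n where "r = gen (GL n) * gen GC - gen GC * gen (GL n)"
      unfolding vir_relators_def by blast
    then show ?thesis
    proof cases
      case L
      define z :: complex where "z = of_int (m ^ 3 - m) / 12"
      have "free_symb c h (?U * r * ?V)
        = Const (k * l) * (word_symb c h (u @ GL m # GL n # v) - word_symb c h (u @ GL n # GL m # v)
          - bracket m (GL n) (\<lambda>g. word_symb c h (u @ g # v)))"
        unfolding L bracket.simps z_def[symmetric]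
        by (simp add: right_diff_distrib left_diff_distrib free_symb_diff three single_mult_gen
            mult_single plus_list_def free_symb_single Const_mult del: of_int_diff)
          (simp add: algebra_simps del: of_int_diff)
      then show ?thesis by (simp add: word_symb_commutator del: bracket.simps)
    next
      case C
      show ?thesis
        using word_symb_central[of c h u "GL n # v"] word_symb_central[of c h "u @ [GL n]" v]
        unfolding C
        by (simp add: right_diff_distrib left_diff_distrib free_symb_diff three single_mult_gen
            mult_single plus_list_def free_symb_single)
    qed
  qed
  have "free_symb c h (Poly_Mapping.single u k * r * b) = 0" for u k
    by (induction b rule: poly_mapping_add_induct) (simp_all add: words distrib_left free_symb_add)
  then show ?thesis
    by (induction a rule: poly_mapping_add_induct) (simp_all add: distrib_right free_symb_add)
qed

text \<open>Passing L_m with m >= 0 over the final L_n yields L_(m+n), again of positive index, and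
  no central term; hence n varies in the induction.\<close>

lemma word_symb_append_pos: "n > 0 \<Longrightarrow> word_symb c h (u @ [GL n]) = 0"
proof (induction "length u" arbitrary: u n)
  case 0
  then show ?case by (simp add: word_symb_nonneg)
next
  case (Suc k)
  then obtain g u' where u: "u = g # u'" and len: "length u' = k" by (cases u) auto
  have IH: "word_symb c h (t @ [GL n]) = 0" if "length t = length u'" "n > 0" for t n
    using Suc.hyps(1)[of t n] that len by simp
  show ?case
  proof (cases g)
    case (GL m)
    have "bracket_word m (\<lambda>t. word_symb c h (t @ [GL n])) u' = bracket_word m (\<lambda>t. 0) u'"
      using Suc.prems by (intro bracket_word_cong IH)
    then show ?thesis
      using Suc.prems by (cases "m < 0") (simp_all add: u GL word_symb_neg word_symb_nonneg IH bracket_word_append)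
  qed (simp add: u IH Suc.prems)
qed

text \<open>Besides the scalar h, moving L_m with m > 0 past L_0 leaves m L_m at the right end,
  which the preceding lemma kills.\<close>

lemma word_symb_append_zero: "word_symb c h (u @ [GL 0]) = Const h * word_symb c h u"
proof (induction "length u" arbitrary: u)
  case 0
  then show ?case by (simp add: word_symb_nonneg)
next
  case (Suc k)
  then obtain g u' where u: "u = g # u'" and len: "length u' = k" by (cases u) auto
  have IH: "word_symb c h (t @ [GL 0]) = Const h * word_symb c h t" if "length t = length u'" for t
    using Suc.hyps(1)[of t] that len by simp
  show ?case
  proof (cases g)
    case (GL m)
    have "bracket_word m (\<lambda>t. word_symb c h (t @ [GL 0])) u' = bracket_word m (\<lambda>t. Const h * word_symb c h t) u'"
      by (intro bracket_word_cong IH)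
    then show ?thesis
      by (cases "m < 0"; cases "m = 0")
        (simp_all add: u GL word_symb_neg word_symb_nonneg IH bracket_word_append rho_Const
          bracket_word_mult word_symb_append_pos algebra_simps)
  qed (simp add: u IH mult.left_commute)
qed

lemma free_symb_verma_ideal: "a \<in> verma_ideal c h \<Longrightarrow> free_symb c h a = 0"
proof (induction rule: verma_ideal.induct)
  case (relator r a b)
  then show ?case by (rule free_symb_relator)
next
  case (char_pos n a)
  then show ?case
    by (induction a rule: poly_mapping_add_induct)
      (simp_all add: single_mult_gen free_symb_single word_symb_append_pos distrib_right free_symb_add)
next
  case (char_zero a)
  show ?case
    by (induction a rule: poly_mapping_add_induct)
      (simp_all add: single_mult_gen free_symb_single word_symb_append_zero distrib_right
        right_diff_distrib free_symb_add free_symb_diff Const_mult)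
next
  case (char_central a)
  show ?case
    using word_symb_central[of c h _ "[]"]
    by (induction a rule: poly_mapping_add_induct)
      (simp_all add: single_mult_gen free_symb_single distrib_right
        right_diff_distrib free_symb_add free_symb_diff Const_mult)
qed (simp_all add: free_symb_add)

section \<open>The action of the free algebra, and the symbol map on the module\<close>

lemma free_act_eq_lin_ext: "free_act M a x = lin_ext (mscale M) (\<lambda>u. foldr (gen_act M) u x) a"
  by (simp add: free_act_def lin_ext_def)

context virasoro_rep
begin

sublocale VS: vector_space "mscale M" by (rule vector_space)

lemma Lop_add: "Lop M n (x + y) = Lop M n x + Lop M n y"
  and Lop_scale: "Lop M n (mscale M k x) = mscale M k (Lop M n x)"
  and Lop_diff: "Lop M n (x - y) = Lop M n x - Lop M n y"
  and Lop_zero [simp]: "Lop M n 0 = 0"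
proof -
  interpret L: Vector_Spaces.linear "mscale M" "mscale M" "Lop M n" by (rule linear_Lop)
  show "Lop M n (x + y) = Lop M n x + Lop M n y" by (rule L.add)
  show "Lop M n (mscale M k x) = mscale M k (Lop M n x)" by (rule L.scale)
  show "Lop M n (x - y) = Lop M n x - Lop M n y" by (rule L.diff)
  show "Lop M n 0 = 0" by (rule L.zero)
qed

lemma free_act_add: "free_act M (a + b) x = free_act M a x + free_act M b x"
  and free_act_diff: "free_act M (a - b) x = free_act M a x - free_act M b x"
  and free_act_single: "free_act M (Poly_Mapping.single u k) x = mscale M k (foldr (gen_act M) u x)"
  by (simp_all add: free_act_eq_lin_ext lin_ext_add[OF vector_space] lin_ext_diff[OF vector_space]
      lin_ext_single[OF vector_space])

lemma free_act_const_mult: "free_act M (const k * a) x = mscale M k (free_act M a x)"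
  using lin_ext_const_mult[OF vector_space, of _ k a]
  by (simp add: free_act_eq_lin_ext const_def zero_list_def)

lemma free_act_gen_mult: "free_act M (gen (GL n) * a) x = Lop M n (free_act M a x)"
  by (induction a rule: poly_mapping_add_induct)
    (simp_all add: gen_def mult_single plus_list_def free_act_single free_act_add distrib_left
      Lop_scale Lop_add)

end

lemma free_symb_const_mult: "free_symb c h (const k * a) = Const k * free_symb c h a"
  using lin_ext_const_mult[OF vector_space_symb, of _ k a]
  by (simp add: free_symb_def const_def zero_list_def)

lemma free_symb_gen_mult: "n < 0 \<Longrightarrow> free_symb c h (gen (GL n) * a) = rho n (free_symb c h a)"
  by (induction a rule: poly_mapping_add_induct)
    (simp_all add: gen_def mult_single plus_list_def free_symb_single free_symb_add distrib_left
      rho_add rho_Const word_symb_neg)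

text \<open>The homomorphism over the subalgebra of negative modes from the Verma module to
  polynomials under \<open>rho\<close>; polynomial degree takes over the role of the PBW
  filtration.\<close>

lemma verma_module_symbol_map:
  assumes "verma_module c h M v"
  obtains e :: "'m::ab_group_add \<Rightarrow> symb" where
    "\<And>x y. e (x + y) = e x + e y" "\<And>k x. e (mscale M k x) = Const k * e x"
    "e v = 1" "\<And>n x. n < 0 \<Longrightarrow> e (Lop M n x) = rho n (e x)"
proof -
  interpret virasoro_rep M using assms by (simp add: verma_module_def)
  define act where "act a = free_act M a v" for a
  have surj: "surj act" and ker: "act a = 0 \<longleftrightarrow> a \<in> verma_ideal c h" for a
    using assms by (simp_all add: verma_module_def act_def)
  \<comment> \<open>Any preimage serves, since two of them differ by an element of the Verma
    ideal.\<close>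
  define e where "e x = free_symb c h (SOME a. act a = x)" for x
  have e: "e (act a) = free_symb c h a" for a
  proof -
    have "act (SOME b. act b = act a) = act a" by (rule someI_ex) blast
    then have "act ((SOME b. act b = act a) - a) = 0" by (simp add: act_def free_act_diff)
    then have "free_symb c h ((SOME b. act b = act a) - a) = 0"
      by (simp add: ker free_symb_verma_ideal)
    then show ?thesis by (simp add: e_def free_symb_diff)
  qed
  show ?thesis
  proof
    fix x y k
    obtain a b where x: "x = act a" and y: "y = act b" using surj by (metis surjD)
    show "e (x + y) = e x + e y"
      using e[of "a + b"] e[of a] e[of b] by (simp add: x y act_def free_act_add free_symb_add)
    show "e (mscale M k x) = Const k * e x"
      using e[of "const k * a"] e[of a] by (simp add: x act_def free_act_const_mult free_symb_const_mult)
    show "e (Lop M n x) = rho n (e x)" if "n < 0" for n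
      using e[of "gen (GL n) * a"] e[of a] that by (simp add: x act_def free_act_gen_mult free_symb_gen_mult)
  next
    show "e v = 1"
      using e[of "Poly_Mapping.single [] 1"] by (simp add: act_def free_act_single free_symb_single)
  qed
qed

section \<open>Vacuum modules\<close>

definition vac_index :: "int list set" where
  "vac_index = {l. sorted l \<and> (\<forall>n\<in>set l. n \<le> - 2)}"

text \<open>Abstract because it is used twice: for V itself and for the representation
  \<open>deformed\<close> on V + W.\<close>

locale vacuum_rep = virasoro_rep M for M :: "'m::ab_group_add vir_mod" +
  fixes c :: complex and x0 :: 'm
  assumes vacuum: "n \<ge> - 1 \<Longrightarrow> Lop M n x0 = 0"
    and central: "Cop M x = mscale M c x"
begin

definition mono :: "int list \<Rightarrow> 'm" where
  "mono l = foldr (Lop M) l x0"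

definition vac_span :: "'m set" where
  "vac_span = VS.span (mono ` vac_index)"

definition vac_filt :: "nat \<Rightarrow> 'm set" where
  "vac_filt k = VS.span (mono ` {l \<in> vac_index. length l \<le> k})"

lemma mono_Cons: "mono (n # l) = Lop M n (mono l)"
  by (simp add: mono_def)

lemma mono_in_filt: "l \<in> vac_index \<Longrightarrow> length l \<le> k \<Longrightarrow> mono l \<in> vac_filt k"
  unfolding vac_filt_def by (intro VS.span_base) auto

lemma mono_in_span: "l \<in> vac_index \<Longrightarrow> mono l \<in> vac_span"
  unfolding vac_span_def by (intro VS.span_base) auto

lemma vac_filt_mono: "j \<le> k \<Longrightarrow> vac_filt j \<subseteq> vac_filt k"
  unfolding vac_filt_def by (intro VS.span_mono) auto

lemma vac_filt_subset_span: "vac_filt k \<subseteq> vac_span"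
  unfolding vac_filt_def vac_span_def by (intro VS.span_mono) auto

lemma subspace_vac: "VS.subspace (vac_filt k)" "VS.subspace vac_span"
  by (simp_all add: vac_filt_def vac_span_def)

lemma Lop_span:
  assumes "y \<in> VS.span B" "VS.subspace S" "\<And>b. b \<in> B \<Longrightarrow> Lop M n b \<in> S"
  shows "Lop M n y \<in> S"
  using assms(1)
proof (induction rule: VS.span_induct)
  case base
  show ?case unfolding VS.subspace_def
    using assms(2) by (auto simp: Lop_add Lop_scale VS.subspace_0 VS.subspace_add VS.subspace_scale)
qed (use assms(3) in auto)

lemma Lop_swap:
  "Lop M m (Lop M n x) = Lop M n (Lop M m x) + mscale M (of_int (m - n)) (Lop M (m + n) x)
     + (if m + n = 0 then mscale M (of_int (m ^ 3 - m) / 12 * c) x else 0)"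
  using Lop_bracket[of m n x] by (simp add: central algebra_simps)

lemma insort_vac_index: "l \<in> vac_index \<Longrightarrow> n \<le> - 2 \<Longrightarrow> insort n l \<in> vac_index"
  by (auto simp: vac_index_def sorted_insort set_insort_key)

text \<open>Moving L_n past L_n' costs a multiple of L_(n+n') with n + n' <= -4: an admissible
  index, one factor fewer, and never a central term.\<close>

lemma Lop_mono:
  assumes "l \<in> vac_index" "n \<le> - 2"
  shows "Lop M n (mono l) - mono (insort n l) \<in> vac_filt (length l)"
  using assms
proof (induction "length l" arbitrary: l n rule: less_induct)
  case less
  have lower: "Lop M n y \<in> vac_filt (Suc k)" if "y \<in> vac_filt k" "k < length l" "n \<le> - 2" for y k n
    using that(1) unfolding vac_filt_def[of k]
  proof (rule Lop_span)
    show "VS.subspace (vac_filt (Suc k))" by (rule subspace_vac)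
    fix b assume "b \<in> mono ` {l \<in> vac_index. length l \<le> k}"
    then obtain r where r: "b = mono r" "r \<in> vac_index" "length r \<le> k" by auto
    have "Lop M n (mono r) - mono (insort n r) \<in> vac_filt (length r)"
      using less.hyps[of r n] r that by simp
    then have "Lop M n (mono r) - mono (insort n r) \<in> vac_filt (Suc k)"
      using vac_filt_mono[of "length r" "Suc k"] r by auto
    moreover have "mono (insort n r) \<in> vac_filt (Suc k)"
      using r that insort_vac_index by (intro mono_in_filt) auto
    ultimately show "Lop M n b \<in> vac_filt (Suc k)"
      using VS.subspace_add[OF subspace_vac(1)] r(1) by fastforce
  qed
  show ?case
  proof (cases l)
    case Nil
    then show ?thesis by (simp add: mono_Cons VS.subspace_0[OF subspace_vac(1)])
  next
    case (Cons n' r)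
    have r: "r \<in> vac_index" "n' \<le> - 2" using less.prems(1) by (auto simp: Cons vac_index_def)
    show ?thesis
    proof (cases "n \<le> n'")
      case True
      then show ?thesis by (simp add: Cons mono_Cons VS.subspace_0[OF subspace_vac(1)])
    next
      case False
      let ?y = "Lop M n (mono r) - mono (insort n r)"
      have "?y \<in> vac_filt (length r)"
        using less.hyps[of r n] r less.prems(2) by (simp add: Cons)
      then have 1: "Lop M n' ?y \<in> vac_filt (length l)"
        using lower[of ?y "length r" n'] r by (simp add: Cons)
      have "mono r \<in> vac_filt (length r)" using r by (intro mono_in_filt) auto
      then have 2: "Lop M (n + n') (mono r) \<in> vac_filt (length l)"
        using lower[of "mono r" "length r" "n + n'"] r less.prems(2) by (simp add: Cons)
      have "Lop M n (mono l) - mono (insort n l)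
        = Lop M n' ?y + mscale M (of_int (n - n')) (Lop M (n + n') (mono r))"
        using False r less.prems(2)
        by (simp add: Cons mono_Cons Lop_swap[of n n'] Lop_diff)
      then show ?thesis
        using 1 2 by (simp add: VS.subspace_add[OF subspace_vac(1)] VS.subspace_scale[OF subspace_vac(1)])
    qed
  qed
qed

lemma Lop_vac_span_neg:
  assumes "y \<in> vac_span" "n \<le> - 2"
  shows "Lop M n y \<in> vac_span"
  using assms(1) unfolding vac_span_def
proof (rule Lop_span)
  fix b assume "b \<in> mono ` vac_index"
  then obtain l where l: "b = mono l" "l \<in> vac_index" by auto
  have "mono (insort n l) \<in> vac_span"
    using l(2) assms(2) by (intro mono_in_span insort_vac_index)
  moreover have "Lop M n b - mono (insort n l) \<in> vac_span"
    using Lop_mono[OF l(2) assms(2)] vac_filt_subset_span l(1) by auto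
  ultimately have "Lop M n b \<in> vac_span"
    using VS.subspace_add[OF subspace_vac(2)] by fastforce
  then show "Lop M n b \<in> VS.span (mono ` vac_index)" by (simp add: vac_span_def)
qed simp

text \<open>L_m is commuted to the right until it meets the vacuum. Each factor it passes has index
  at most -2, so putting that factor back in front stays in the span by reordering.\<close>

lemma Lop_mono_in_span:
  assumes "l \<in> vac_index"
  shows "Lop M m (mono l) \<in> vac_span"
  using assms
proof (induction l arbitrary: m)
  case Nil
  show ?case
  proof (cases "m \<ge> - 1")
    case True
    then show ?thesis by (simp add: mono_def vacuum VS.subspace_0[OF subspace_vac(2)])
  next
    case False
    then show ?thesis using Nil by (intro Lop_vac_span_neg mono_in_span) auto
  qed
next
  case (Cons n r)
  have r: "r \<in> vac_index" "n \<le> - 2" using Cons.prems by (auto simp: vac_index_def)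
  have "Lop M n (Lop M m (mono r)) \<in> vac_span"
    using Cons.IH[OF r(1)] r(2) by (rule Lop_vac_span_neg)
  then show ?case
    using Cons.IH[OF r(1), of "m + n"] mono_in_span[OF r(1)]
    by (auto simp: mono_Cons Lop_swap[of m n] intro!: VS.subspace_add[OF subspace_vac(2)]
        VS.subspace_scale[OF subspace_vac(2)] VS.subspace_0[OF subspace_vac(2)])
qed

lemma Lop_vac_span: "y \<in> vac_span \<Longrightarrow> Lop M m y \<in> vac_span"
  unfolding vac_span_def
  by (erule Lop_span) (use Lop_mono_in_span in \<open>auto simp: vac_span_def\<close>)

lemma vacuum_in_span: "x0 \<in> vac_span"
  using mono_in_span[of "[]"] by (simp add: mono_def vac_index_def)

lemma vac_span_explicit:
  assumes "y \<in> vac_span"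
  obtains T a where "finite T" "T \<subseteq> vac_index" "y = (\<Sum>l\<in>T. mscale M (a l) (mono l))"
proof -
  from assms obtain t r where t: "finite t" "t \<subseteq> mono ` vac_index" and y: "y = (\<Sum>b\<in>t. mscale M (r b) b)"
    by (auto simp: vac_span_def VS.span_explicit)
  \<comment> \<open>Choosing one list for each vector makes \<open>mono\<close> injective on
    \<open>T\<close>, which is not known on all of \<open>vac_index\<close>.\<close>
  from t(2) obtain T where T: "T \<subseteq> vac_index" "inj_on mono T" "t = mono ` T"
    by (meson subset_image_inj)
  have "finite T" using t(1) T by (auto dest: finite_imageD)
  moreover have "y = (\<Sum>l\<in>T. mscale M (r (mono l)) (mono l))"
    using T by (simp add: y sum.reindex)
  ultimately show ?thesis using that[of T "\<lambda>l. r (mono l)"] T by blast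
qed

end

section \<open>Vertex operator calculus\<close>

lemma Sum_any_eq_sum_lessThan:
  fixes f :: "nat \<Rightarrow> 'a::comm_monoid_add"
  assumes "\<And>i. i \<ge> N \<Longrightarrow> f i = 0"
  shows "Sum_any f = (\<Sum>i<N. f i)"
proof -
  have "{i. f i \<noteq> 0} \<subseteq> {..<N}" using assms by (auto simp: not_le[symmetric])
  then show ?thesis by (intro Sum_any.expand_superset) auto
qed

lemma sum_square_eq_sum_triangle:
  fixes g :: "nat \<Rightarrow> nat \<Rightarrow> 'a::comm_monoid_add"
  assumes "\<And>i j. i + j \<ge> N \<Longrightarrow> g i j = 0"
  shows "(\<Sum>i<N. \<Sum>j<N. g i j) = (\<Sum>k<N. \<Sum>i\<le>k. g i (k - i))"
proof -
  have "(\<Sum>i<N. \<Sum>j<N. g i j) = (\<Sum>(i, j)\<in>{..<N} \<times> {..<N}. g i j)"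
    by (simp add: sum.cartesian_product)
  also have "\<dots> = (\<Sum>(i, j)\<in>{(i, j). i + j < N}. g i j)"
    using assms by (intro sum.mono_neutral_right) (auto, metis not_less)
  also have "\<dots> = (\<Sum>k<N. \<Sum>i\<le>k. g i (k - i))"
    by (rule sum.triangle_reindex)
  finally show ?thesis .
qed

text \<open>Negating the upper index of the second factor absorbs the signs and leaves a Vandermonde
  sum with total upper index k - b - 1; negating again gives b. Used to reverse the roles in the
  commutator formula for \<open>YWV\<close>.\<close>

lemma gbinomial_alternating_convolution:
  fixes a b :: "'a::field_char_0"
  shows "(\<Sum>j\<le>k. (-1) ^ j * (a gchoose j) * ((a + b - of_nat j) gchoose (k - j))) = (b gchoose k)"
proof -
  have "(-1) ^ j * (a gchoose j) * ((a + b - of_nat j) gchoose (k - j))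
    = (-1) ^ k * ((a gchoose j) * ((of_nat k - (a + b) - 1) gchoose (k - j)))" if "j \<le> k" for j
  proof -
    have "(a + b - of_nat j) gchoose (k - j)
      = (-1) ^ (k - j) * ((of_nat k - (a + b) - 1) gchoose (k - j))"
      using that by (subst gbinomial_negated_upper) (simp add: of_nat_diff algebra_simps)
    moreover have "(-1) ^ j * (-1) ^ (k - j) = ((-1) ^ k :: 'a)"
      using that by (simp flip: power_add)
    ultimately show ?thesis by (simp add: mult.commute mult.left_commute)
  qed
  then have "(\<Sum>j\<le>k. (-1) ^ j * (a gchoose j) * ((a + b - of_nat j) gchoose (k - j)))
    = (-1) ^ k * (\<Sum>j\<le>k. (a gchoose j) * ((of_nat k - (a + b) - 1) gchoose (k - j)))"
    unfolding sum_distrib_left by (intro sum.cong refl) simp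
  also have "\<dots> = (-1) ^ k * ((a + (of_nat k - (a + b) - 1)) gchoose k)"
    
    using gbinomial_Vandermonde[of a "of_nat k - (a + b) - 1" k] by (simp only: atMost_atLeast0)
  also have "\<dots> = b gchoose k"
    by (subst (2) gbinomial_negated_upper) (simp add: algebra_simps)
  finally show ?thesis .
qed

abbreviation sgn_pow :: "int \<Rightarrow> complex" where
  "sgn_pow n \<equiv> (-1) powi n"

lemma sgn_pow_add: "sgn_pow (m + n) = sgn_pow m * sgn_pow n"
  by (simp add: power_int_add)

lemma sgn_pow_diff: "sgn_pow (m - n) = sgn_pow m * sgn_pow n"
  by (simp add: power_int_diff power_int_minus1_right divide_eq_eq) 

lemma sgn_pow_of_nat: "sgn_pow (int k) = (-1) ^ k"
  by simp

section \<open>Consequences of the Jacobi identity, and divided powers of L(-1)\<close>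

context vertex_operators
begin

sublocale VV: vector_space "vscale V" by (rule vector_space_V)
sublocale VW: vector_space s by (rule vector_space_W)

lemma Z_add_left: "Z (u + u') n x = Z u n x + Z u' n x"
  and Z_scale_left: "Z (vscale V k u) n x = s k (Z u n x)"
  and Z_zero_left [simp]: "Z 0 n x = 0"
proof -
  interpret L: Vector_Spaces.linear "vscale V" s "\<lambda>u. Z u n x" by (rule linear_left)
  show "Z (u + u') n x = Z u n x + Z u' n x" by (rule L.add)
  show "Z (vscale V k u) n x = s k (Z u n x)" by (rule L.scale)
  show "Z 0 n x = 0" by (rule L.zero)
qed

lemma Z_add: "Z u n (x + x') = Z u n x + Z u n x'"
  and Z_scale: "Z u n (s k x) = s k (Z u n x)"
  and Z_zero [simp]: "Z u n 0 = 0"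
  and Z_sum: "Z u n (sum f A) = (\<Sum>i\<in>A. Z u n (f i))"
proof -
  interpret L: Vector_Spaces.linear s s "Z u n" by (rule linear_right)
  show "Z u n (x + x') = Z u n x + Z u n x'" by (rule L.add)
  show "Z u n (s k x) = s k (Z u n x)" by (rule L.scale)
  show "Z u n 0 = 0" by (rule L.zero)
  show "Z u n (sum f A) = (\<Sum>i\<in>A. Z u n (f i))" by (rule L.sum)
qed

lemma eventually_Z_eq_0: "\<forall>\<^sub>F i in sequentially. Z u (m + int i) x = 0"
proof -
  obtain N where N: "\<And>n. n \<ge> N \<Longrightarrow> Z u n x = 0" using truncation by blast
  show ?thesis
    unfolding eventually_sequentially by (intro exI[of _ "nat (N - m)"] allI impI N) auto
qed

text \<open>The Jacobi identity at l = 0, where the binomials on the right leave only i = 0. The sum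
  may be cut off by vanishing products or, for m >= 0, by vanishing binomials.\<close>

lemma commutator_formula:
  assumes "\<And>i. i \<ge> N \<Longrightarrow> (of_int m :: complex) gchoose i = 0 \<or> Y V u (int i) v = 0"
  shows "Z u m (Z v n x) - Z v n (Z u m x)
    = (\<Sum>i<N. s ((of_int m :: complex) gchoose i) (Z (Y V u (int i) v) (m + n - int i) x))"
proof -
  have "Sum_any (\<lambda>i::nat. s ((-1) ^ i * ((of_int 0 :: complex) gchoose i))
       (Z u (m + 0 - int i) (Z v (n + int i) x) - s ((- 1) powi 0) (Z v (n + 0 - int i) (Z u (m + int i) x))))
    = (\<Sum>i<1. s ((-1) ^ i * ((of_int 0 :: complex) gchoose i))
       (Z u (m + 0 - int i) (Z v (n + int i) x) - s ((- 1) powi 0) (Z v (n + 0 - int i) (Z u (m + int i) x))))"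
    by (intro Sum_any_eq_sum_lessThan) (auto simp: gbinomial_0_left)
  also have "\<dots> = Z u m (Z v n x) - Z v n (Z u m x)" by simp
  finally show ?thesis
    unfolding jacobi[symmetric]
    by (subst (asm) Sum_any_eq_sum_lessThan[where N = N]) (use assms in force)+
qed

text \<open>The Jacobi identity at m = 0, where the binomials on the left leave only i = 0.\<close>

lemma iterate_formula:
  assumes "\<And>i. i \<ge> N \<Longrightarrow> Z v (n + int i) x = 0" "\<And>i. i \<ge> N \<Longrightarrow> Z u (int i) x = 0"
  shows "Z (Y V u l v) n x
    = (\<Sum>i<N. s ((-1) ^ i * ((of_int l :: complex) gchoose i))
        (Z u (l - int i) (Z v (n + int i) x) - s (sgn_pow l) (Z v (n + l - int i) (Z u (int i) x))))"
proof -
  have "Z (Y V u l v) n x = (\<Sum>i<1. s ((of_int 0 :: complex) gchoose i) (Z (Y V u (l + int i) v) (0 + n - int i) x))"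
    by simp
  also have "\<dots> = Sum_any (\<lambda>i::nat. s ((of_int 0 :: complex) gchoose i) (Z (Y V u (l + int i) v) (0 + n - int i) x))"
    by (intro Sum_any_eq_sum_lessThan[symmetric]) (auto simp: gbinomial_0_left)
  also have "\<dots> = (\<Sum>i<N. s ((-1) ^ i * ((of_int l :: complex) gchoose i))
        (Z u (l - int i) (Z v (n + int i) x) - s (sgn_pow l) (Z v (n + l - int i) (Z u (int i) x))))"
    unfolding jacobi by (subst Sum_any_eq_sum_lessThan[where N = N]) (simp_all add: assms)
  finally show ?thesis .
qed

abbreviation T :: "'w \<Rightarrow> 'w" where
  "T \<equiv> Z (conf V) 0"

lemma T_commutator: "Z u n (T x) = T (Z u n x) + s (of_int n) (Z u (n - 1) x)"
proof -
  have "T (Z u n x) - Z u n (T x) = Z (LV V (- 1) u) n x"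
    by (subst commutator_formula[where N = 1]) (auto simp: LV_def gbinomial_0_left)
  then show ?thesis by (simp add: derivative algebra_simps)
qed

text \<open>The coefficients of e^(xT); dividing by the factorial keeps the identities below purely
  binomial.\<close>

definition T_div :: "nat \<Rightarrow> 'w \<Rightarrow> 'w" where
  "T_div i x = s (1 / fact i) ((T ^^ i) x)"

lemma T_div_0 [simp]: "T_div 0 x = x"
  by (simp add: T_div_def)

lemma T_pow_linear: "(T ^^ i) (x + y) = (T ^^ i) x + (T ^^ i) y" "(T ^^ i) (s k x) = s k ((T ^^ i) x)"
  by (induction i) (simp_all add: Z_add Z_scale)

lemma T_div_add: "T_div i (x + y) = T_div i x + T_div i y"
  and T_div_scale: "T_div i (s k x) = s k (T_div i x)"
  by (simp_all add: T_div_def T_pow_linear VW.scale_right_distrib mult.commute)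

lemma T_div_zero [simp]: "T_div i 0 = 0"
  using T_div_scale[of i 0 0] by simp

lemma T_div_diff: "T_div i (x - y) = T_div i x - T_div i y"
  using T_div_add[of i "x - y" y] by simp

lemma T_div_sum: "T_div i (sum f A) = (\<Sum>j\<in>A. T_div i (f j))"
  by (induction A rule: infinite_finite_induct) (simp_all add: T_div_add)

lemma T_T_div: "T (T_div i x) = s (of_nat (Suc i)) (T_div (Suc i) x)"
proof -
  have "of_nat (Suc i) * (1 / fact (Suc i)) = (1 / fact i :: complex)"
    by (simp add: divide_simps del: of_nat_Suc)
  then show ?thesis by (simp add: T_div_def Z_scale del: fact_Suc of_nat_Suc)
qed

lemma T_div_T: "T_div i (T x) = s (of_nat (Suc i)) (T_div (Suc i) x)"
proof -
  have "T_div i (T x) = T (T_div i x)"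
    by (simp add: T_div_def Z_scale funpow_swap1)
  then show ?thesis by (simp add: T_T_div)
qed

text \<open>The coefficient form of e^(-xT) Y(u,z) e^(xT) = Y(u, z-x). In the induction both sides
  are multiplied by i + 1, which arises as the sum of the weights i + 1 - k and k of the k-th
  term.\<close>

lemma Z_T_div:
  "Z u n (T_div i x) = (\<Sum>k\<le>i. s (of_int n gchoose k) (T_div (i - k) (Z u (n - int k) x)))"
proof (induction i arbitrary: n)
  case (Suc i)
  let ?f = "\<lambda>k. T_div (Suc i - k) (Z u (n - int k) x)"
  have "s (of_nat (Suc i)) (Z u n (T_div (Suc i) x)) = Z u n (T (T_div i x))"
    by (simp add: T_T_div Z_scale del: of_nat_Suc)
  also have "\<dots> = T (Z u n (T_div i x)) + s (of_int n) (Z u (n - 1) (T_div i x))"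
    by (rule T_commutator)
  also have "T (Z u n (T_div i x)) = (\<Sum>k\<le>i. s (of_nat (Suc i - k) * (of_int n gchoose k)) (?f k))"
    unfolding Suc.IH Z_sum by (intro sum.cong) (simp_all add: Z_scale T_T_div Suc_diff_le mult.commute)
  also have "\<dots> = (\<Sum>k\<le>Suc i. s (of_nat (Suc i - k) * (of_int n gchoose k)) (?f k))"
    by simp
  also have "s (of_int n) (Z u (n - 1) (T_div i x))
    = (\<Sum>k\<le>i. s (of_nat (Suc k) * (of_int n gchoose Suc k)) (?f (Suc k)))"
  proof -
    have "of_int n * ((of_int n - 1) gchoose k) = of_nat (Suc k) * (of_int n gchoose Suc k :: complex)" for k
      using gbinomial_absorption[of k "of_int n :: complex"] by simp
    moreover have arg: "n - 1 - int k = n - int (Suc k)" for k by simp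
    ultimately show ?thesis
      unfolding Suc.IH VW.scale_sum_right arg
      by (intro sum.cong) (simp_all del: of_nat_Suc)
  qed
  also have "\<dots> = (\<Sum>k\<le>Suc i. s (of_nat k * (of_int n gchoose k)) (?f k))"
    by (subst sum.atMost_Suc_shift) simp
  also have "(\<Sum>k\<le>Suc i. s (of_nat (Suc i - k) * (of_int n gchoose k)) (?f k)) + \<dots>
    = s (of_nat (Suc i)) (\<Sum>k\<le>Suc i. s (of_int n gchoose k) (?f k))"
    unfolding VW.scale_sum_right sum.distrib[symmetric]
    by (intro sum.cong refl)
      (simp add: VW.scale_left_distrib[symmetric] distrib_right[symmetric] of_nat_add[symmetric] del: of_nat_Suc of_nat_add)
  finally show ?case by (simp del: of_nat_Suc sum.atMost_Suc)
qed simp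

end

section \<open>The modes on V of vectors of W\<close>

context voa_module
begin

sublocale U: vertex_operator_algebra c V by (rule voa)
sublocale W: vertex_operators V "wscale W" "YW W" by (rule vertex_operators)
sublocale V: vertex_operators V "vscale V" "Y V" by (rule U.vertex_operators)

abbreviation YWV' :: "'w \<Rightarrow> int \<Rightarrow> 'v \<Rightarrow> 'w" where
  "YWV' \<equiv> YWV V W"

lemma LW_minus_1: "LW V W (- 1) = W.T"
  by (simp add: LW_def)

lemma LV_minus_1: "LV V (- 1) = V.T"
  by (simp add: LV_def)

lemma YWV_eq_sum:
  assumes "\<And>i. i \<ge> N \<Longrightarrow> YW W v (n + int i) y = 0"
  shows "YWV' y n v = (\<Sum>i<N. wscale W (sgn_pow (n + int i + 1)) (W.T_div i (YW W v (n + int i) y)))"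
proof -
  have "(W.T ^^ i) 0 = 0" for i by (induction i) simp_all
  then show ?thesis
    unfolding YWV_def LW_minus_1
    by (subst Sum_any_eq_sum_lessThan[where N = N]) (simp_all add: assms W.T_div_def)
qed

lemma eventually_YW_eq_0: "\<exists>N. \<forall>i\<ge>N. YW W v (n + int i) y = 0"
  using W.eventually_Z_eq_0[of v n y] by (simp add: eventually_sequentially)

lemma YWV_add_left: "YWV' (y + y') n v = YWV' y n v + YWV' y' n v"
proof -
  obtain N where "\<forall>i\<ge>N. YW W v (n + int i) y = 0 \<and> YW W v (n + int i) y' = 0"
    using eventually_conj[OF W.eventually_Z_eq_0[of v n y] W.eventually_Z_eq_0[of v n y']]
    by (auto simp: eventually_sequentially)
  then show ?thesis
    by (subst (1 2 3) YWV_eq_sum[where N = N])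
      (simp_all add: W.Z_add W.T_div_add W.VW.scale_right_distrib sum.distrib)
qed

lemma YWV_scale_left: "YWV' (wscale W k y) n v = wscale W k (YWV' y n v)"
proof -
  obtain N where "\<forall>i\<ge>N. YW W v (n + int i) y = 0"
    using eventually_YW_eq_0 by blast
  then show ?thesis
    by (subst (1 2) YWV_eq_sum[where N = N])
      (simp_all add: W.Z_scale W.T_div_scale W.VW.scale_sum_right mult.commute)
qed

lemma YWV_add: "YWV' y n (v + v') = YWV' y n v + YWV' y n v'"
proof -
  obtain N where "\<forall>i\<ge>N. YW W v (n + int i) y = 0 \<and> YW W v' (n + int i) y = 0"
    using eventually_conj[OF W.eventually_Z_eq_0[of v n y] W.eventually_Z_eq_0[of v' n y]]
    by (auto simp: eventually_sequentially)
  then show ?thesis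
    by (subst (1 2 3) YWV_eq_sum[where N = N])
      (simp_all add: W.Z_add_left W.T_div_add W.VW.scale_right_distrib sum.distrib)
qed

lemma YWV_scale: "YWV' y n (vscale V k v) = wscale W k (YWV' y n v)"
proof -
  obtain N where "\<forall>i\<ge>N. YW W v (n + int i) y = 0"
    using eventually_YW_eq_0 by blast
  then show ?thesis
    by (subst (1 2) YWV_eq_sum[where N = N])
      (simp_all add: W.Z_scale_left W.T_div_scale W.VW.scale_sum_right mult.commute)
qed

lemma YWV_zero_left [simp]: "YWV' 0 n v = 0"
  using YWV_scale_left[of 0 0] by simp

lemma YWV_zero [simp]: "YWV' y n 0 = 0"
  using YWV_scale[of y n 0 0] by simp

lemma YWV_sum_left: "YWV' (sum f A) n v = (\<Sum>i\<in>A. YWV' (f i) n v)"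
  by (induction A rule: infinite_finite_induct) (simp_all add: YWV_add_left)

lemma YWV_vac: "YWV' y n (vac V) = (if n \<ge> 0 then 0 else W.T_div (nat (- n - 1)) y)"
proof -
  have "YWV' y n (vac V) = (\<Sum>i<Suc (nat (- n - 1)). wscale W (sgn_pow (n + int i + 1)) (W.T_div i (YW W (vac V) (n + int i) y)))"
    by (rule YWV_eq_sum) (auto simp: W.identity)
  also have "\<dots> = (\<Sum>i<Suc (nat (- n - 1)). if i = nat (- n - 1) \<and> n < 0 then W.T_div i y else 0)"
    by (intro sum.cong refl) (auto simp: W.identity)
  also have "\<dots> = (if n \<ge> 0 then 0 else W.T_div (nat (- n - 1)) y)"
    by (cases "n \<ge> 0") (simp_all del: sum.lessThan_Suc)
  finally show ?thesis .
qed

text \<open>Commuting T past v_(n+i) contributes the weight -(n+i), and the product of T with a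
  divided power contributes i after an index shift; the total is -n.\<close>

lemma YWV_T: "YWV' (W.T y) n v = wscale W (- of_int n) (YWV' y (n - 1) v)"
proof -
  obtain N where N: "\<forall>i\<ge>N. YW W v (n - 1 + int i) y = 0"
    using eventually_YW_eq_0 by blast
  let ?f = "\<lambda>i. W.T_div i (YW W v (n - 1 + int i) y)"
  have z: "YW W v (n + int i) y = 0" if "i \<ge> N" for i
    using N[rule_format, of "Suc i"] that by simp
  have "YWV' (W.T y) n v = (\<Sum>i<N. wscale W (sgn_pow (n + int i + 1)) (W.T_div i (YW W v (n + int i) (W.T y))))"
    using N by (intro YWV_eq_sum) (simp add: W.T_commutator z algebra_simps)
  also have "\<dots> = (\<Sum>i<N. wscale W (sgn_pow (n + int (Suc i)) * of_nat (Suc i)) (?f (Suc i)))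
     + (\<Sum>i<N. wscale W (- (sgn_pow (n + int i) * of_int (n + int i))) (?f i))"
  proof -
    have arg: "n + int i - 1 = n - 1 + int i" for i by simp
    show ?thesis
      unfolding sum.distrib[symmetric]
      by (intro sum.cong refl)
        (simp add: W.T_commutator W.T_div_add W.T_div_T W.T_div_scale W.VW.scale_right_distrib
          sgn_pow_add arg)
  qed
  also have "(\<Sum>i<N. wscale W (sgn_pow (n + int (Suc i)) * of_nat (Suc i)) (?f (Suc i)))
    = (\<Sum>i<Suc N. wscale W (sgn_pow (n + int i) * of_nat i) (?f i))"
    by (subst sum.lessThan_Suc_shift) simp
  also have "\<dots> = (\<Sum>i<N. wscale W (sgn_pow (n + int i) * of_nat i) (?f i))"
    using N by simp
  also have "\<dots> + (\<Sum>i<N. wscale W (- (sgn_pow (n + int i) * of_int (n + int i))) (?f i))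
    = (\<Sum>i<N. wscale W (- of_int n) (wscale W (sgn_pow (n - 1 + int i + 1)) (?f i)))"
    unfolding sum.distrib[symmetric]
    by (intro sum.cong refl)
      (simp only: W.VW.scale_left_distrib[symmetric] W.VW.scale_scale, simp add: algebra_simps)
  also have "\<dots> = wscale W (- of_int n) (YWV' y (n - 1) v)"
    using N unfolding W.VW.scale_sum_right[symmetric] by (subst YWV_eq_sum[where N = N]) auto
  finally show ?thesis .
qed

lemma YWV_T_div: "YWV' (W.T_div i y) n v = wscale W ((-1) ^ i * (of_int n gchoose i)) (YWV' y (n - int i) v)"
proof (induction i arbitrary: n)
  case (Suc i)
  have "wscale W (of_nat (Suc i)) (YWV' (W.T_div (Suc i) y) n v) = YWV' (W.T (W.T_div i y)) n v"
    by (simp only: YWV_scale_left W.T_T_div)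
  also have "\<dots> = wscale W (- of_int n * ((-1) ^ i * (of_int (n - 1) gchoose i))) (YWV' y (n - 1 - int i) v)"
    by (simp add: YWV_T Suc.IH)
  also have "- of_int n * ((-1) ^ i * (of_int (n - 1) gchoose i))
     = of_nat (Suc i) * ((-1) ^ Suc i * (of_int n gchoose Suc i) :: complex)"
    using gbinomial_absorption[of i "of_int n :: complex"] by (simp add: mult.left_commute del: of_nat_Suc)
  also have "n - 1 - int i = n - int (Suc i)" by simp
  finally show ?case
    unfolding W.VW.scale_scale[symmetric, of "of_nat (Suc i)"]
    by (rule W.VW.scale_left_imp_eq[rotated]) (simp del: of_nat_Suc)
qed simp

text \<open>With y_m written by skew symmetry, u_n passes the divided powers by
  \<open>Z_T_div\<close>, while the modes of u_n v come from the iterate formula. The terms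
  \<open>?A\<close> cancel and the terms \<open>?B\<close> reassemble into modes of u_j y.\<close>

lemma YW_YWV_commutator:
  assumes J: "\<And>j. j \<ge> J \<Longrightarrow> YW W u (int j) y = 0"
  shows "YW W u n (YWV' y m v) - YWV' y m (Y V u n v)
    = (\<Sum>j<J. wscale W (of_int n gchoose j) (YWV' (YW W u (int j) y) (m + n - int j) v))"
proof -
  \<comment> \<open>One bound \<open>N\<close> has to truncate the modes of v on all the vectors u_j
    y with j < J as well as on y.\<close>
  have "\<forall>\<^sub>F i in sequentially. \<forall>j\<in>{..<J}. YW W v (m + n - int j + int i) (YW W u (int j) y) = 0"
    by (intro eventually_ball_finite finite_lessThan ballI W.eventually_Z_eq_0)
  from eventually_conj[OF this eventually_conj[OF W.eventually_Z_eq_0[of v m y]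
        eventually_conj[OF W.eventually_Z_eq_0[of "Y V u n v" m y] eventually_ge_at_top[of J]]]]
  obtain N where N: "\<And>i j. i \<ge> N \<Longrightarrow> j < J \<Longrightarrow> YW W v (m + n - int j + int i) (YW W u (int j) y) = 0"
    "\<And>i. i \<ge> N \<Longrightarrow> YW W v (m + int i) y = 0" "\<And>i. i \<ge> N \<Longrightarrow> YW W (Y V u n v) (m + int i) y = 0"
    "J \<le> N"
    unfolding eventually_sequentially by auto
  let ?s = "wscale W" and ?C = "\<lambda>k. of_int n gchoose k :: complex"
  let ?A = "\<lambda>i k. W.T_div i (YW W u (n - int k) (YW W v (m + int i + int k) y))"
  let ?B = "\<lambda>i k. W.T_div i (YW W v (m + int i + n - int k) (YW W u (int k) y))"
  have 1: "YW W u n (YWV' y m v) = (\<Sum>i<N. \<Sum>k<N. ?s (sgn_pow (m + int i + 1) * (-1) ^ k * ?C k) (?A i k))"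
  proof -
    have "YW W u n (YWV' y m v) = (\<Sum>l<N. ?s (sgn_pow (m + int l + 1)) (YW W u n (W.T_div l (YW W v (m + int l) y))))"
      by (subst YWV_eq_sum[OF N(2)]) (simp_all add: W.Z_sum W.Z_scale)
    also have "\<dots> = (\<Sum>l<N. \<Sum>k\<le>l. ?s (sgn_pow (m + int (l - k) + 1) * (-1) ^ k * ?C k) (?A (l - k) k))"
    proof (intro sum.cong refl)
      fix l
      have "sgn_pow (m + int l + 1) * ?C k = sgn_pow (m + int (l - k) + 1) * (-1) ^ k * ?C k" if "k \<le> l" for k
      proof -
        from that obtain d where "l = k + d" by (auto simp: le_iff_add)
        then show ?thesis
          by (simp only: add_diff_cancel_left' of_nat_add sgn_pow_add sgn_pow_of_nat mult_ac)
      qed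
      moreover have "m + int (l - k) + int k = m + int l" if "k \<le> l" for k using that by simp
      ultimately show "?s (sgn_pow (m + int l + 1)) (YW W u n (W.T_div l (YW W v (m + int l) y)))
        = (\<Sum>k\<le>l. ?s (sgn_pow (m + int (l - k) + 1) * (-1) ^ k * ?C k) (?A (l - k) k))"
        unfolding W.Z_T_div W.VW.scale_sum_right W.VW.scale_scale by (intro sum.cong refl) simp
    qed
    \<comment> \<open>The triangle of indices may be enlarged to a square because v_(m+i+k) y = 0
      once i + k >= N.\<close>
    also have "\<dots> = (\<Sum>k<N. \<Sum>i<N. ?s (sgn_pow (m + int i + 1) * (-1) ^ k * ?C k) (?A i k))"
      by (intro sum_square_eq_sum_triangle[symmetric]) (simp add: N(2) add.assoc flip: of_nat_add)
    also have "\<dots> = (\<Sum>i<N. \<Sum>k<N. ?s (sgn_pow (m + int i + 1) * (-1) ^ k * ?C k) (?A i k))"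
      by (rule sum.swap)
    finally show ?thesis .
  qed
  have 2: "YWV' y m (Y V u n v) = (\<Sum>i<N. \<Sum>k<N. ?s (sgn_pow (m + int i + 1) * (-1) ^ k * ?C k)
      (?A i k - ?s (sgn_pow n) (?B i k)))"
  proof -
    have "YW W (Y V u n v) (m + int i) y = (\<Sum>k<N. ?s ((-1) ^ k * ?C k)
       (YW W u (n - int k) (YW W v (m + int i + int k) y)
        - ?s (sgn_pow n) (YW W v (m + int i + n - int k) (YW W u (int k) y))))" for i
      using N(2)[of "i + _"] J N(4) by (intro W.iterate_formula) (simp_all add: add.assoc)
    then show ?thesis
      by (subst YWV_eq_sum[OF N(3)])
        (simp_all add: W.T_div_sum W.T_div_scale W.T_div_diff W.VW.scale_sum_right mult.assoc)
  qed
  have 3: "(\<Sum>j<J. ?s (?C j) (YWV' (YW W u (int j) y) (m + n - int j) v))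
    = (\<Sum>i<N. \<Sum>k<N. ?s (sgn_pow (m + int i + 1) * (-1) ^ k * ?C k * sgn_pow n) (?B i k))"
  proof -
    have "?s (?C j) (YWV' (YW W u (int j) y) (m + n - int j) v)
       = (\<Sum>i<N. ?s (sgn_pow (m + int i + 1) * (-1) ^ j * ?C j * sgn_pow n) (?B i j))" if "j < J" for j
    proof -
      have e: "m + n - int j + int i = m + int i + n - int j" for i by simp
      have sg: "sgn_pow (m + int i + n - int j + 1) = sgn_pow (m + int i + 1) * sgn_pow n * (-1) ^ j" for i
        by (simp only: sgn_pow_add sgn_pow_diff sgn_pow_of_nat mult_ac)
      show ?thesis
        using that by (subst YWV_eq_sum[OF N(1)])
          (simp_all only: W.VW.scale_sum_right e sg W.VW.scale_scale mult_ac)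
    qed
    then have "(\<Sum>j<J. ?s (?C j) (YWV' (YW W u (int j) y) (m + n - int j) v))
      = (\<Sum>j<J. \<Sum>i<N. ?s (sgn_pow (m + int i + 1) * (-1) ^ j * ?C j * sgn_pow n) (?B i j))"
      by simp
    also have "\<dots> = (\<Sum>j<N. \<Sum>i<N. ?s (sgn_pow (m + int i + 1) * (-1) ^ j * ?C j * sgn_pow n) (?B i j))"
      using N(4) J by (intro sum.mono_neutral_left) auto
    also have "\<dots> = (\<Sum>i<N. \<Sum>j<N. ?s (sgn_pow (m + int i + 1) * (-1) ^ j * ?C j * sgn_pow n) (?B i j))"
      by (rule sum.swap)
    finally show ?thesis .
  qed
  show ?thesis
    unfolding 1 2 3 sum_subtractf[symmetric]
    by (intro sum.cong refl) (simp add: W.VW.scale_right_diff_distrib)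
qed

text \<open>Deduced from the previous formula: y_j u is a combination of divided powers of T on
  u_(j+i) y, whose modes are known by \<open>YWV_T_div\<close>, and the coefficients of (u_k
  y)_(m+n-k) collapse to -binom(n, k).\<close>

lemma YWV_YW_commutator:
  assumes J: "\<And>j. j \<ge> J \<Longrightarrow> YW W u (int j) y = 0"
  shows "YWV' y m (Y V u n v) - YW W u n (YWV' y m v)
    = (\<Sum>j<J. wscale W (of_int m gchoose j) (YWV' (YWV' y (int j) u) (m + n - int j) v))"
proof -
  let ?s = "wscale W"
  let ?g = "\<lambda>j i. ?s (- ((-1) ^ j * (of_int m gchoose j) * ((of_int m + of_int n - of_nat j) gchoose i)))
      (YWV' (YW W u (int (j + i)) y) (m + n - int (j + i)) v)"
  have "?s (of_int m gchoose j) (YWV' (YWV' y (int j) u) (m + n - int j) v) = (\<Sum>i<J. ?g j i)" for j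
  proof -
    have "sgn_pow (int j + int i + 1) * (-1) ^ i = - ((-1) ^ j)" for i
      by (simp add: sgn_pow_add)
    then have "(of_int m gchoose j) * (sgn_pow (int j + int i + 1) * ((-1) ^ i * x))
      = - ((-1) ^ j * (of_int m gchoose j) * x)" for i x
      by (simp add: mult.assoc[symmetric] mult.commute[of "of_int m gchoose j"])
    moreover have "YW W u (int j + int i) y = 0" if "i \<ge> J" for i
      using J[of "j + i"] that by simp
    ultimately show ?thesis
      by (subst YWV_eq_sum[where N = J])
        (simp_all add: YWV_sum_left YWV_scale_left YWV_T_div W.VW.scale_sum_right diff_diff_eq)
  qed
  then have "(\<Sum>j<J. ?s (of_int m gchoose j) (YWV' (YWV' y (int j) u) (m + n - int j) v))
    = (\<Sum>j<J. \<Sum>i<J. ?g j i)" by simp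
  also have "\<dots> = (\<Sum>k<J. \<Sum>j\<le>k. ?g j (k - j))"
    by (intro sum_square_eq_sum_triangle) (simp only: J YWV_zero_left W.VW.scale_zero_right)
  also have "\<dots> = (\<Sum>k<J. - ?s (of_int n gchoose k) (YWV' (YW W u (int k) y) (m + n - int k) v))"
  proof (intro sum.cong refl)
    fix k
    have "(\<Sum>j\<le>k. ?g j (k - j)) = (\<Sum>j\<le>k. ?s (- ((-1) ^ j * (of_int m gchoose j) * ((of_int m + of_int n - of_nat j) gchoose (k - j))))
      (YWV' (YW W u (int k) y) (m + n - int k) v))"
      by (intro sum.cong refl) simp
    also have "\<dots> = - ?s (\<Sum>j\<le>k. (-1) ^ j * (of_int m gchoose j) * ((of_int m + of_int n - of_nat j) gchoose (k - j)))
      (YWV' (YW W u (int k) y) (m + n - int k) v)"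
      by (simp add: W.VW.scale_sum_left sum_negf)
    finally show "(\<Sum>j\<le>k. ?g j (k - j)) = - ?s (of_int n gchoose k) (YWV' (YW W u (int k) y) (m + n - int k) v)"
      by (simp add: gbinomial_alternating_convolution)
  qed
  also have "\<dots> = - (YW W u n (YWV' y m v) - YWV' y m (Y V u n v))"
    by (simp only: YW_YWV_commutator[OF J] sum_negf)
  finally show ?thesis by simp
qed

end

section \<open>Independence of the vacuum monomials\<close>

definition deg_le :: "nat \<Rightarrow> symb \<Rightarrow> bool" where
  "deg_le k P \<longleftrightarrow> (\<forall>M. size M > k \<longrightarrow> Poly_Mapping.lookup P M = 0)"

text \<open>
  Monomials containing \<open>x\<close> with index \<open>-1\<close> are disregarded, because no monomial of the vacuum module
  has a factor \<open>L(-1)\<close> while modes applied to the lowest weight vector of \<open>W\<close> produce such factors.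
\<close>

definition small :: "nat \<Rightarrow> symb \<Rightarrow> bool" where
  "small k P \<longleftrightarrow> deg_le k P \<and> (\<forall>M. size M = k \<longrightarrow> - 1 \<notin># M \<longrightarrow> Poly_Mapping.lookup P M = 0)"

lemma lookup_Const_mult: "Poly_Mapping.lookup (Const k * P) M = k * Poly_Mapping.lookup P M"
  by (induction P rule: poly_mapping_add_induct)
    (simp_all add: Const_mult_single lookup_single when_def distrib_left lookup_add)

lemma lookup_Var_mult:
  "Poly_Mapping.lookup (Var n * P) M = (if n \<in># M then Poly_Mapping.lookup P (M - {#n#}) else 0)"
proof (induction P rule: poly_mapping_add_induct)
  case (single N k)
  show ?case
    by (auto simp: Var_def mult_single lookup_single when_def)
qed (simp add: distrib_left lookup_add)

lemma deg_le_zero [simp]: "deg_le k 0"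
  and deg_le_add: "deg_le k P \<Longrightarrow> deg_le k Q \<Longrightarrow> deg_le k (P + Q)"
  and deg_le_diff: "deg_le k P \<Longrightarrow> deg_le k Q \<Longrightarrow> deg_le k (P - Q)"
  and deg_le_Const: "deg_le k P \<Longrightarrow> deg_le k (Const a * P)"
  by (simp_all add: deg_le_def lookup_add lookup_minus lookup_Const_mult)

lemma small_zero [simp]: "small k 0"
  and small_add: "small k P \<Longrightarrow> small k Q \<Longrightarrow> small k (P + Q)"
  and small_diff: "small k P \<Longrightarrow> small k Q \<Longrightarrow> small k (P - Q)"
  and small_Const: "small k P \<Longrightarrow> small k (Const a * P)"
  and small_deg_le: "small k P \<Longrightarrow> deg_le k P"
  and deg_le_small: "deg_le k P \<Longrightarrow> small (Suc k) P"
  by (simp_all add: small_def deg_le_add deg_le_diff deg_le_Const lookup_add lookup_minus lookup_Const_mult)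
    (simp add: deg_le_def)

lemma deg_le_sum: "(\<And>i. i \<in> A \<Longrightarrow> deg_le k (f i)) \<Longrightarrow> deg_le k (sum f A)"
  and small_sum: "(\<And>i. i \<in> A \<Longrightarrow> small k (f i)) \<Longrightarrow> small k (sum f A)"
  by (induction A rule: infinite_finite_induct) (simp_all add: deg_le_add small_add)

lemma lookup_derM: "size N \<noteq> size M \<Longrightarrow> Poly_Mapping.lookup (derM m M) N = 0"
proof (induction M arbitrary: N)
  case (add l M)
  have "Const (of_int (m - l)) * Var (m + l) * Poly_Mapping.single M 1
      = Poly_Mapping.single (add_mset (m + l) M) (of_int (m - l))"
    by (simp add: Var_def Const_mult_single mult_single del: of_int_diff)
  moreover have "Poly_Mapping.lookup (derM m M) (N - {#l#}) = 0" if "l \<in># N"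
    using add.prems size_Suc_Diff1[OF that] by (intro add.IH) auto
  ultimately show ?case
    using add.prems by (auto simp: derM_add_mset lookup_add lookup_Var_mult lookup_single when_def)
qed (simp add: derM_def)

lemma deg_le_der:
  assumes "deg_le k P"
  shows "deg_le k (der m P)"
  unfolding der_def lin_ext_def
proof (rule deg_le_sum)
  fix M assume "M \<in> Poly_Mapping.keys P"
  then have "size M \<le> k" using assms by (auto simp: deg_le_def in_keys_iff not_less[symmetric])
  then show "deg_le k (symb_scale (Poly_Mapping.lookup P M) (derM m M))"
    by (intro deg_le_Const) (simp add: deg_le_def lookup_derM)
qed

text \<open>\<open>der\<close> preserves the degree, so the top degree sees only the multiplication
  by m x_m.\<close>

lemma lookup_rho_top:
  assumes "deg_le k P" "size M = Suc k"
  shows "Poly_Mapping.lookup (rho m P) M = of_int m * (if m \<in># M then Poly_Mapping.lookup P (M - {#m#}) else 0)"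
  using deg_le_der[OF assms(1), of m] assms(2)
  by (simp add: rho_def lookup_add lookup_Const_mult lookup_Var_mult deg_le_def)

lemma deg_le_rho:
  assumes "deg_le k P"
  shows "deg_le (Suc k) (rho m P)"
  using deg_le_der[OF assms, of m] assms
  by (auto simp: deg_le_def rho_def lookup_add lookup_Const_mult lookup_Var_mult size_Diff_singleton)

lemma small_rho: "small k P \<Longrightarrow> small (Suc k) (rho m P)"
proof -
  assume P: "small k P"
  have "Poly_Mapping.lookup P (M - {#m#}) = 0" if "size M = Suc k" "- 1 \<notin># M" "m \<in># M" for M
  proof -
    have "size (M - {#m#}) = k" "- 1 \<notin># M - {#m#}"
      using that by (auto simp: size_Diff_singleton dest: in_diffD)
    then show ?thesis using P by (simp add: small_def)
  qed
  moreover have "deg_le k P" using P by (rule small_deg_le)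
  ultimately show ?thesis
    by (simp add: small_def deg_le_rho lookup_rho_top)
qed

text \<open>All top-degree terms carry the factor x_(-1), which \<open>small\<close>
  disregards.\<close>

lemma small_rho_minus_1: "deg_le k P \<Longrightarrow> small (Suc k) (rho (- 1) P)"
  by (auto simp: small_def deg_le_rho lookup_rho_top)

lemma verma_module_generator:
  assumes "verma_module c h M v"
  shows "n > 0 \<Longrightarrow> Lop M n v = 0" "Lop M 0 v = mscale M h v"
proof -
  interpret virasoro_rep M using assms by (simp add: verma_module_def)
  have ker: "free_act M a v = 0" if "a \<in> verma_ideal c h" for a
    using assms that by (simp add: verma_module_def)
  have 1: "free_act M (1 * gen (GL n)) v = Lop M n v" for n
    by (simp add: gen_def free_act_single)
  show "Lop M n v = 0" if "n > 0"
    using ker[OF verma_ideal.char_pos[OF that]] 1 by metis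
  have "free_act M (1 * (gen (GL 0) - const h)) v = Lop M 0 v - mscale M h v"
    using 1[of 0] by (simp add: free_act_diff const_def free_act_single)
  then show "Lop M 0 v = mscale M h v"
    using ker[OF verma_ideal.char_zero[of 1]] by simp
qed

section \<open>Symbols of vacuum monomials acting on the Verma generator\<close>

context voa_module
begin

sublocale VM: vacuum_rep "vir_of_voa c V" c "vac V"
proof (intro vacuum_rep.intro vacuum_rep_axioms.intro U.virasoro)
  show "Lop (vir_of_voa c V) n (vac V) = 0" if "n \<ge> - 1" for n
    using that U.creation_regular[of "n + 1"] by (simp add: vir_of_voa_def LV_def)
qed (simp add: vir_of_voa_def)

sublocale WM: virasoro_rep "vir_of_mod c V W" by (rule virasoro)

lemma vir_of_simps [simp]:
  "mscale (vir_of_voa c V) = vscale V" "Lop (vir_of_voa c V) = LV V" "Cop (vir_of_voa c V) = vscale V c"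
  "mscale (vir_of_mod c V W) = wscale W" "Lop (vir_of_mod c V W) = LW V W" "Cop (vir_of_mod c V W) = wscale W c"
  by (simp_all add: vir_of_voa_def vir_of_mod_def)

text \<open>Induction on l. The iterate formula splits (L(n)u)_N w into terms \<open>P\<close>,
  where L(n-i) acts last, and terms \<open>Q\<close>, where L(i-1) acts first on w. For N = -1 only
  \<open>P\<close> with i = 0 is not small: it contributes n x_n times the leading term of u_(-1)
  w.\<close>

lemma monomial_symbol:
  fixes e :: "'w \<Rightarrow> symb" and w :: 'w
  assumes e_add: "\<And>x y. e (x + y) = e x + e y" and e_scale: "\<And>k x. e (wscale W k x) = Const k * e x"
    and e_w: "e w = 1" and e_LW': "\<forall>n<0. \<forall>x. e (LW V W n x) = rho n (e x)"
    and w: "\<forall>n>0. LW V W n w = 0" "LW V W 0 w = wscale W h w"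
    and l: "\<forall>n\<in>set l. n \<le> - 2"
  shows "deg_le (length l) (e (YW W (VM.mono l) N w))"
    and "N \<ge> 0 \<Longrightarrow> small (length l) (e (YW W (VM.mono l) N w))"
    and "size M = length l \<Longrightarrow> - 1 \<notin># M \<Longrightarrow>
      Poly_Mapping.lookup (e (YW W (VM.mono l) (- 1) w)) M = (if M = mset l then \<Prod>n\<leftarrow>l. of_int n else 0)"
proof -
  have e_LW: "e (LW V W n x) = rho n (e x)" if "n < 0" for n x using e_LW' that by blast
  have e_zero [simp]: "e 0 = 0" using e_scale[of 0 0] by simp
  have e_diff: "e (x - y) = e x - e y" for x y using e_add[of "x - y" y] by simp
  have e_sum: "e (sum f A) = (\<Sum>i\<in>A. e (f i))" for f :: "nat \<Rightarrow> 'w" and A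
    by (induction A rule: infinite_finite_induct) (simp_all add: e_add)
  have "(\<forall>N. deg_le (length l) (e (YW W (VM.mono l) N w)))
    \<and> (\<forall>N\<ge>0. small (length l) (e (YW W (VM.mono l) N w)))
    \<and> (\<forall>M. size M = length l \<longrightarrow> - 1 \<notin># M \<longrightarrow>
      Poly_Mapping.lookup (e (YW W (VM.mono l) (- 1) w)) M = (if M = mset l then \<Prod>n\<leftarrow>l. of_int n else 0))"
    using l
  proof (induction l)
    case Nil
    have "deg_le 0 1"
      by (auto simp: deg_le_def lookup_one when_def)
    then show ?case
      by (auto simp: VM.mono_def W.identity e_w lookup_one when_def)
  next
    case (Cons n l)
    let ?u = "VM.mono l" and ?k = "length l"
    have n: "n \<le> - 2" and IH: "\<And>N. deg_le ?k (e (YW W ?u N w))"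
      "\<And>N. N \<ge> 0 \<Longrightarrow> small ?k (e (YW W ?u N w))"
      "\<And>M. size M = ?k \<Longrightarrow> - 1 \<notin># M \<Longrightarrow>
        Poly_Mapping.lookup (e (YW W ?u (- 1) w)) M = (if M = mset l then \<Prod>n\<leftarrow>l. of_int n else 0)"
      using Cons by auto
    define P where "P N i = e (YW W (conf V) (n + 1 - int i) (YW W ?u (N + int i) w))" for N i
    define Q where "Q N i = e (YW W ?u (N + (n + 1) - int i) (YW W (conf V) (int i) w))" for N i
    have P: "P N i = rho (n - int i) (e (YW W ?u (N + int i) w))" for N i
    proof -
      have eq: "n + 1 - int i = n - int i + 1" by simp
      show ?thesis unfolding P_def eq using n e_LW[of "n - int i"] by (simp add: LW_def)
    qed
    \<comment> \<open>On the lowest weight vector only L(-1) and L(0), from i = 0 and i = 1,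
      survive. L(-1) is moved to the left, where it creates x_(-1) in top degree, and L(0) is a
      scalar adding no factor.\<close>
    have Q: "small (Suc ?k) (Q N i)" for N i
    proof -
      consider "i = 0" | "i = 1" | "i \<ge> 2" by linarith
      then show ?thesis
      proof cases
        case 1
        then show ?thesis
          using e_LW[of "- 1"]
          by (simp add: Q_def W.T_commutator e_add e_scale LW_minus_1 IH(1) small_rho_minus_1 small_add
              small_Const deg_le_small)
      next
        case 2
        then show ?thesis
          using w(2) by (simp add: Q_def LW_def W.Z_scale e_scale small_Const deg_le_small IH(1))
      next
        case 3
        then show ?thesis
          using w(1)[rule_format, of "int i - 1"] by (simp add: Q_def LW_def)
      qed
    qed
    \<comment> \<open>The range is \<open>Suc J\<close> so that the term i = 0 can always be split
      off.\<close>
    have expand: "\<exists>J. e (YW W (VM.mono (n # l)) N w)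
      = (\<Sum>i<Suc J. Const ((-1) ^ i * (of_int (n + 1) gchoose i)) * (P N i - Const (sgn_pow (n + 1)) * Q N i))" for N
    proof -
      obtain J where J: "\<forall>i\<ge>J. YW W ?u (N + int i) w = 0 \<and> YW W (conf V) (0 + int i) w = 0"
        using eventually_conj[OF W.eventually_Z_eq_0[of ?u N w] W.eventually_Z_eq_0[of "conf V" 0 w]]
        by (auto simp: eventually_sequentially)
      have "YW W (VM.mono (n # l)) N w = YW W (Y V (conf V) (n + 1) ?u) N w"
        by (simp add: VM.mono_Cons LV_def)
      also have "\<dots> = (\<Sum>i<Suc J. wscale W ((- 1) ^ i * (of_int (n + 1) gchoose i))
        (YW W (conf V) (n + 1 - int i) (YW W ?u (N + int i) w)
         - wscale W (sgn_pow (n + 1)) (YW W ?u (N + (n + 1) - int i) (YW W (conf V) (int i) w))))"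
        using J by (intro W.iterate_formula) auto
      finally show ?thesis
        by (intro exI[of _ J]) (simp only: e_sum e_scale e_diff P_def Q_def)
    qed
    show ?case
    proof (intro conjI allI impI)
      fix N
      have "deg_le (Suc ?k) (P N i)" for i
        unfolding P by (intro deg_le_rho IH)
      moreover obtain J where J: "e (YW W (VM.mono (n # l)) N w)
        = (\<Sum>i<Suc J. Const ((-1) ^ i * (of_int (n + 1) gchoose i)) * (P N i - Const (sgn_pow (n + 1)) * Q N i))"
        using expand by blast
      ultimately show "deg_le (length (n # l)) (e (YW W (VM.mono (n # l)) N w))"
        unfolding J list.size(4) add_Suc_right add_0_right using Q
        by (intro deg_le_sum deg_le_Const deg_le_diff small_deg_le[of _ "Q N _"])
      assume "N \<ge> 0"
      then have "small (Suc ?k) (P N i)" for i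
        unfolding P by (intro small_rho IH) simp
      then show "small (length (n # l)) (e (YW W (VM.mono (n # l)) N w))"
        using expand[of N] Q by (auto intro!: small_sum small_Const small_diff simp del: sum.lessThan_Suc)
    next
      fix M :: "int multiset" assume M: "size M = length (n # l)" "- 1 \<notin># M"
      \<comment> \<open>For i >= 1 the inner mode has index i - 1 >= 0, where the induction
        hypothesis gives smallness.\<close>
      have P_small: "small (Suc ?k) (P (- 1) (Suc i))" for i
        unfolding P by (intro small_rho IH) simp
      obtain J where J: "e (YW W (VM.mono (n # l)) (- 1) w) = (\<Sum>i<Suc J. Const ((-1) ^ i * (of_int (n + 1) gchoose i))
          * (P (- 1) i - Const (sgn_pow (n + 1)) * Q (- 1) i))"
        using expand by blast
      define R where "R = e (YW W (VM.mono (n # l)) (- 1) w) - P (- 1) 0"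
      have "R = (\<Sum>i<J. Const ((-1) ^ Suc i * (of_int (n + 1) gchoose Suc i))
          * (P (- 1) (Suc i) - Const (sgn_pow (n + 1)) * Q (- 1) (Suc i))) - Const (sgn_pow (n + 1)) * Q (- 1) 0"
        unfolding R_def J by (subst sum.lessThan_Suc_shift) simp
      also have "small (Suc ?k) \<dots>"
        using P_small Q by (intro small_diff small_sum small_Const)
      finally have "Poly_Mapping.lookup R M = 0"
        using M by (simp add: small_def)
      then have "Poly_Mapping.lookup (e (YW W (VM.mono (n # l)) (- 1) w)) M = Poly_Mapping.lookup (P (- 1) 0) M"
        by (simp add: R_def lookup_minus)
      also have "\<dots> = of_int n * (if n \<in># M then Poly_Mapping.lookup (e (YW W ?u (- 1) w)) (M - {#n#}) else 0)"
        using M lookup_rho_top[OF IH(1), of M n "- 1"] by (simp add: P)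
      also have "\<dots> = (if M = mset (n # l) then \<Prod>n\<leftarrow>n # l. of_int n else 0)"
      proof (cases "n \<in># M")
        case True
        have "M - {#n#} = mset l \<longleftrightarrow> M = mset (n # l)"
          using insert_DiffM[OF True] by (metis add_mset_remove_trivial mset.simps(2))
        moreover have "size (M - {#n#}) = ?k" "- 1 \<notin># M - {#n#}"
          using M True by (auto simp: size_Diff_singleton dest: in_diffD)
        ultimately show ?thesis using True by (simp add: IH(3))
      qed auto
      finally show "Poly_Mapping.lookup (e (YW W (VM.mono (n # l)) (- 1) w)) M
        = (if M = mset (n # l) then \<Prod>n\<leftarrow>n # l. of_int n else 0)" .
    qed
  qed
  then show "deg_le (length l) (e (YW W (VM.mono l) N w))"
    and "N \<ge> 0 \<Longrightarrow> small (length l) (e (YW W (VM.mono l) N w))"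
    and "size M = length l \<Longrightarrow> - 1 \<notin># M \<Longrightarrow>
      Poly_Mapping.lookup (e (YW W (VM.mono l) (- 1) w)) M = (if M = mset l then \<Prod>n\<leftarrow>l. of_int n else 0)"
    by auto
qed

text \<open>Among the lists with nonzero coefficient let l0 have maximal length. The coefficient of
  the monomial of l0 in the symbols sees only l0: shorter lists have smaller degree, and sorted
  lists of equal length are separated by their multisets.\<close>

lemma mono_independent:
  assumes verma: "verma_module c h (vir_of_mod c V W) w"
    and T: "finite T" "T \<subseteq> vac_index"
    and zero: "(\<Sum>l\<in>T. vscale V (a l) (VM.mono l)) = 0"
    and l: "l \<in> T"
  shows "a l = 0"
proof (rule ccontr)
  assume "a l \<noteq> 0"
  obtain e :: "'w \<Rightarrow> symb" where e: "\<And>x y. e (x + y) = e x + e y"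
    "\<And>k x. e (wscale W k x) = Const k * e x" "e w = 1"
    "\<forall>n<0. \<forall>x. e (LW V W n x) = rho n (e x)"
    using verma_module_symbol_map[OF verma] by (metis vir_of_simps(4,5))
  have "\<forall>n>0. LW V W n w = 0" "LW V W 0 w = wscale W h w"
    using verma_module_generator[OF verma] by simp_all
  note symbol = monomial_symbol[OF e this]
  define f where "f l = e (YW W (VM.mono l) (- 1) w)" for l
  have e_zero: "e 0 = 0" using e(2)[of 0 0] by simp
  have "e (YW W (\<Sum>l\<in>S. vscale V (a l) (VM.mono l)) (- 1) w) = (\<Sum>l\<in>S. Const (a l) * f l)" if "finite S" for S
    using that by (induction S rule: finite_induct)
      (simp_all add: W.Z_add_left W.Z_scale_left e e_zero f_def)
  from this[OF T(1)] have sum: "(\<Sum>l\<in>T. Const (a l) * f l) = 0"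
    using zero by (simp add: e_zero)
  define S where "S = {l\<in>T. a l \<noteq> 0}"
  have "finite (length ` S)" "length ` S \<noteq> {}"
    using T(1) l \<open>a l \<noteq> 0\<close> by (auto simp: S_def)
  from Max_in[OF this] Max_ge[OF this(1)]
  obtain l0 where l0: "l0 \<in> S" and max: "\<And>l. l \<in> S \<Longrightarrow> length l \<le> length l0"
    by (metis (no_types, lifting) image_iff)
  have idx: "sorted l" "\<forall>n\<in>set l. n \<le> - 2" if "l \<in> T" for l
    using T(2) that by (auto simp: vac_index_def)
  have l0T: "l0 \<in> T" and al0: "a l0 \<noteq> 0" using l0 by (auto simp: S_def)
  have "a l * Poly_Mapping.lookup (f l) (mset l0) = (if l = l0 then a l0 * (\<Prod>n\<leftarrow>l0. of_int n) else 0)" if "l \<in> T" for l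
  proof (cases "a l = 0")
    case False
    then have len: "length l \<le> length l0" using max that by (simp add: S_def)
    have neg: "- 1 \<notin># mset l0" using idx(2)[OF l0T] by auto
    show ?thesis
    proof (cases "length l = length l0")
      case True
      have "mset l0 = mset l \<longleftrightarrow> l = l0"
        using idx(1)[OF that] idx(1)[OF l0T] by (metis properties_for_sort)
      then show ?thesis
        using symbol(3)[OF idx(2)[OF that], of "mset l0"] neg True by (simp add: f_def)
    next
      case False
      then show ?thesis
        using symbol(1)[OF idx(2)[OF that], of "- 1"] len by (auto simp: f_def deg_le_def)
    qed
  qed (use al0 in auto)
  then have "Poly_Mapping.lookup (\<Sum>l\<in>T. Const (a l) * f l) (mset l0)
    = (\<Sum>l\<in>T. if l = l0 then a l0 * (\<Prod>n\<leftarrow>l0. of_int n) else 0)"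
    by (simp add: lookup_sum lookup_Const_mult)
  then have "a l0 * (\<Prod>n\<leftarrow>l0. of_int n) = 0"
    using sum l0T T(1) by simp
  then show False using al0 idx(2)[OF l0T] by (auto simp: prod_list_zero_iff)
qed

end

section \<open>The derivation\<close>

text \<open>The Verma generator \<open>w1\<close> serves the independence of monomials and
  \<open>w\<close> defines the cocycle; the two are not identified. Apart from the VOA axioms, V
  enters through \<open>generated\<close> alone.\<close>

locale lowest_weight_derivation = voa_module c V W
  for c :: complex and V :: "'v::ab_group_add voa" and W :: "('v, 'w::ab_group_add) voa_mod" +
  fixes w w1 :: 'w
  assumes generated: "\<And>S. W.VV.subspace S \<Longrightarrow> vac V \<in> S \<Longrightarrow> (\<And>n v. v \<in> S \<Longrightarrow> LV V n v \<in> S) \<Longrightarrow> S = UNIV"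
    and verma: "verma_module c 1 (vir_of_mod c V W) w1"
    and w_pos: "n > 0 \<Longrightarrow> LW V W n w = 0"
    and w_zero: "LW V W 0 w = w"
begin

text \<open>The mode F(omega)_(m+1) for the prescribed F(omega) = L(-1)w, the inhomogeneous term in
  the derivation property at u = omega.\<close>

definition phi :: "int \<Rightarrow> 'v \<Rightarrow> 'w" where
  "phi m v = YWV' (W.T w) (m + 1) v"

lemma phi_eq: "phi m v = wscale W (- of_int (m + 1)) (YWV' w m v)"
  by (simp add: phi_def YWV_T)

text \<open>Only j = 0 and j = 1 contribute: L(-1)w gives -(m+n+1) and L(0)w = w gives m + 1. Weight
  1 is what makes m drop out.\<close>

lemma LW_YWV_commutator:
  "LW V W m (YWV' w n v) - YWV' w n (LV V m v) = wscale W (- of_int n) (YWV' w (m + n) v)"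
proof -
  have "YW W (conf V) (int j) w = 0" if "j \<ge> 2" for j
    using w_pos[of "int j - 1"] that by (simp add: LW_def)
  note YW_YWV_commutator[OF this, where n = "m + 1" and m = n and v = v]
  moreover have "YW W (conf V) 1 w = w"
    using w_zero by (simp add: LW_def)
  moreover have "YWV' (W.T w) (n + (m + 1)) v = wscale W (- of_int (n + m + 1)) (YWV' w (m + n) v)"
    by (simp add: YWV_T add.commute[of m n])
  ultimately have "LW V W m (YWV' w n v) - YWV' w n (LV V m v)
    = wscale W (- of_int (n + m + 1)) (YWV' w (m + n) v) + wscale W (of_int (m + 1)) (YWV' w (m + n) v)"
    by (simp add: LW_def LV_def numeral_2_eq_2 add.commute[of m n])
  also have "\<dots> = wscale W (- of_int n) (YWV' w (m + n) v)"
    unfolding W.VW.scale_left_distrib[symmetric] by simp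
  finally show ?thesis .
qed

lemma LW_phi_commutator:
  "LW V W m (phi n v) - phi n (LV V m v) = wscale W (of_int ((n + 1) * n)) (YWV' w (m + n) v)"
proof -
  have "LW V W m (phi n v) - phi n (LV V m v)
    = wscale W (- of_int (n + 1)) (LW V W m (YWV' w n v) - YWV' w n (LV V m v))"
    by (simp only: phi_eq W.VW.scale_right_diff_distrib WM.Lop_scale[simplified])
  moreover have "- of_int (n + 1) * - of_int n = (of_int ((n + 1) * n) :: complex)"
    by (simp add: algebra_simps)
  ultimately show ?thesis by (simp only: LW_YWV_commutator W.VW.scale_scale)
qed

text \<open>By the preceding lemma this is n(n+1) - m(m+1) = -(m-n)(m+n+1).\<close>

lemma phi_cocycle:
  "(LW V W m (phi n v) - phi n (LV V m v)) - (LW V W n (phi m v) - phi m (LV V n v))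
    = wscale W (of_int (m - n)) (phi (m + n) v)"
proof -
  have "(n + 1) * n - (m + 1) * m = (m - n) * (- (m + n + 1))" by (simp add: algebra_simps)
  then have "(of_int ((n + 1) * n) - of_int ((m + 1) * m) :: complex) = of_int (m - n) * (- of_int (m + n + 1))"
    by (simp only: of_int_diff[symmetric] of_int_mult[symmetric] of_int_minus[symmetric])
  then show ?thesis
    by (simp only: LW_phi_commutator phi_eq[of "m + n"] add.commute[of n m] W.VW.scale_scale
        W.VW.scale_left_diff_distrib[symmetric])
qed

section \<open>The extension of V by W defined by the cocycle\<close>

text \<open>A section v \<mapsto> (v, F v) of the projection to V is a homomorphism exactly when F
  is linear and satisfies \<open>F_LV\<close>.\<close>

definition deformed :: "('v \<times> 'w) vir_mod" where
  "deformed = \<lparr>mscale = (\<lambda>k y. (vscale V k (fst y), wscale W k (snd y))),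
     Lop = (\<lambda>n y. (LV V n (fst y), LW V W n (snd y) + phi n (fst y))),
     Cop = (\<lambda>y. (vscale V c (fst y), wscale W c (snd y)))\<rparr>"

lemma deformed_simps [simp]:
  "mscale deformed = (\<lambda>k y. (vscale V k (fst y), wscale W k (snd y)))"
  "Lop deformed = (\<lambda>n y. (LV V n (fst y), LW V W n (snd y) + phi n (fst y)))"
  "Cop deformed = (\<lambda>y. (vscale V c (fst y), wscale W c (snd y)))"
  by (simp_all add: deformed_def)

lemmas L_linear = VM.Lop_add[simplified] VM.Lop_scale[simplified] WM.Lop_add[simplified] WM.Lop_scale[simplified]

lemma vector_space_deformed: "vector_space (mscale deformed)"
  by unfold_locales
    (simp_all add: W.VV.scale_right_distrib W.VV.scale_left_distrib
      W.VW.scale_right_distrib W.VW.scale_left_distrib plus_prod_def)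

sublocale X: vacuum_rep deformed c "(vac V, 0)"
proof (intro vacuum_rep.intro virasoro_rep.intro vacuum_rep_axioms.intro vector_space_deformed)
  interpret D: vector_space "mscale deformed" by (rule vector_space_deformed)
  have lin: "Vector_Spaces.linear (mscale deformed) (mscale deformed) f"
    if "\<And>x y. f (x + y) = f x + f y" "\<And>k x. f (mscale deformed k x) = mscale deformed k (f x)" for f
    using that by (simp add: Vector_Spaces.linear_def module_hom_iff D.module_axioms vector_space_deformed
        del: deformed_simps)
  show "Vector_Spaces.linear (mscale deformed) (mscale deformed) (Lop deformed n)" for n
    by (rule lin) (simp_all add: L_linear phi_def YWV_add YWV_scale W.VW.scale_right_distrib plus_prod_def add_ac)
  show "Vector_Spaces.linear (mscale deformed) (mscale deformed) (Cop deformed)"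
    by (rule lin) (simp_all add: W.VV.scale_right_distrib W.VW.scale_right_distrib plus_prod_def mult.commute)
  show "Lop deformed n (Cop deformed x) = Cop deformed (Lop deformed n x)" for n x
    by (simp add: L_linear phi_def YWV_scale W.VW.scale_right_distrib)
  show "Lop deformed m (Lop deformed n x) - Lop deformed n (Lop deformed m x)
    = mscale deformed (of_int (m - n)) (Lop deformed (m + n) x)
      + (if m + n = 0 then mscale deformed (of_int (m ^ 3 - m) / 12) (Cop deformed x) else 0)" for m n x
  proof (rule prod_eqI)
    show "fst (Lop deformed m (Lop deformed n x) - Lop deformed n (Lop deformed m x))
      = fst (mscale deformed (of_int (m - n)) (Lop deformed (m + n) x)
         + (if m + n = 0 then mscale deformed (of_int (m ^ 3 - m) / 12) (Cop deformed x) else 0))"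
      using VM.Lop_bracket[of m n "fst x"] by (cases "m + n = 0") simp_all
    show "snd (Lop deformed m (Lop deformed n x) - Lop deformed n (Lop deformed m x))
      = snd (mscale deformed (of_int (m - n)) (Lop deformed (m + n) x)
         + (if m + n = 0 then mscale deformed (of_int (m ^ 3 - m) / 12) (Cop deformed x) else 0))"
      using WM.Lop_bracket[of m n "snd x"] phi_cocycle[of m n "fst x"]
      by (cases "m + n = 0") (simp_all add: L_linear W.VW.scale_right_distrib algebra_simps)
  qed
  \<comment> \<open>For n >= 0 the mode w_n kills the vacuum; for n = -1 the factor -(n+1) of
    \<open>phi_eq\<close> vanishes.\<close>
  show "Lop deformed n (vac V, 0) = 0" if "n \<ge> - 1" for n
    using VM.vacuum[OF that] that WM.Lop_zero[of n]
    by (cases "n = - 1") (simp_all add: phi_eq YWV_vac zero_prod_def)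
  show "Cop deformed x = mscale deformed c x" for x by simp
qed

lemma fst_mono: "fst (X.mono l) = VM.mono l"
  by (induction l) (simp_all add: X.mono_def VM.mono_def)

lemma graph_injective:
  assumes "y \<in> X.vac_span" "fst y = 0"
  shows "y = 0"
proof -
  obtain T a where T: "finite T" "T \<subseteq> vac_index" and y: "y = (\<Sum>l\<in>T. mscale deformed (a l) (X.mono l))"
    using X.vac_span_explicit[OF assms(1)] .
  have "(\<Sum>l\<in>T. vscale V (a l) (VM.mono l)) = fst y"
    by (simp add: y fst_sum fst_mono)
  then have "a l = 0" if "l \<in> T" for l
    using mono_independent[OF verma T _ that] assms(2) by simp
  then show ?thesis by (simp add: y flip: zero_prod_def)
qed

lemma graph_total: "\<exists>x. (v, x) \<in> X.vac_span"
proof -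
  have "fst ` X.vac_span = UNIV"
  proof (rule generated)
    show "W.VV.subspace (fst ` X.vac_span)"
      unfolding W.VV.subspace_def
    proof (intro conjI ballI allI)
      show "0 \<in> fst ` X.vac_span"
        using X.VS.subspace_0[OF X.subspace_vac(2)] by (force simp: zero_prod_def)
      show "a + b \<in> fst ` X.vac_span" if "a \<in> fst ` X.vac_span" "b \<in> fst ` X.vac_span" for a b
        using that X.VS.subspace_add[OF X.subspace_vac(2)] by (force simp flip: fst_add)
      show "vscale V k a \<in> fst ` X.vac_span" if "a \<in> fst ` X.vac_span" for k a
        using that X.VS.subspace_scale[OF X.subspace_vac(2), of _ k] by force
    qed
    show "vac V \<in> fst ` X.vac_span"
      using X.vacuum_in_span by force
    show "LV V n v \<in> fst ` X.vac_span" if "v \<in> fst ` X.vac_span" for n v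
      using that X.Lop_vac_span[of _ n] by force
  qed
  then show ?thesis by (metis UNIV_I imageE prod.collapse)
qed

section \<open>The map F and its derivation property\<close>

definition F :: "'v \<Rightarrow> 'w" where
  "F v = (SOME x. (v, x) \<in> X.vac_span)"

lemma F_graph: "(v, F v) \<in> X.vac_span"
  unfolding F_def using graph_total by (rule someI_ex)

lemma F_eqI:
  assumes "(v, x) \<in> X.vac_span"
  shows "F v = x"
proof -
  have "(v, F v) - (v, x) \<in> X.vac_span"
    using F_graph assms by (rule X.VS.subspace_diff[OF X.subspace_vac(2)])
  from graph_injective[OF this] show ?thesis by (simp add: zero_prod_def)
qed

lemma F_add: "F (u + v) = F u + F v"
  using X.VS.subspace_add[OF X.subspace_vac(2) F_graph[of u] F_graph[of v]] by (intro F_eqI) simp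

lemma F_scale: "F (vscale V k v) = wscale W k (F v)"
  using X.VS.subspace_scale[OF X.subspace_vac(2) F_graph[of v], of k] by (intro F_eqI) simp

lemma F_zero [simp]: "F 0 = 0"
  using F_scale[of 0 0] by simp

lemma F_diff: "F (u - v) = F u - F v"
  using F_add[of "u - v" v] by simp

lemma F_sum: "F (sum f A) = (\<Sum>i\<in>A. F (f i))"
  by (induction A rule: infinite_finite_induct) (simp_all add: F_add)

lemma F_vac [simp]: "F (vac V) = 0"
  using X.vacuum_in_span by (rule F_eqI)

lemma F_LV: "F (LV V n v) = LW V W n (F v) + phi n v"
  using X.Lop_vac_span[OF F_graph[of v], of n] by (intro F_eqI) simp

lemma F_conf: "F (conf V) = LW V W (- 1) w"
proof -
  have "conf V = LV V (- 2) (vac V)"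
    using U.creation[of "conf V"] by (simp add: LV_def)
  then have "F (conf V) = phi (- 2) (vac V)"
    using F_LV[of "- 2" "vac V"] WM.Lop_zero by simp
  then show ?thesis by (simp add: phi_def YWV_vac LW_minus_1)
qed

text \<open>The operator w_0 commutes with every L(m), since the factor -n is 0, and it kills the
  vacuum, which generates V. As \<open>phi 0\<close> is -w_0, this makes F preserve the
  grading.\<close>

lemma YWV_w_zero: "YWV' w 0 v = 0"
proof -
  have "{v. YWV' w 0 v = 0} = UNIV"
  proof (rule generated)
    show "W.VV.subspace {v. YWV' w 0 v = 0}"
      by (simp add: W.VV.subspace_def YWV_add YWV_scale)
    show "vac V \<in> {v. YWV' w 0 v = 0}" by (simp add: YWV_vac)
    show "LV V n v \<in> {v. YWV' w 0 v = 0}" if "v \<in> {v. YWV' w 0 v = 0}" for n v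
      using that LW_YWV_commutator[of n 0 v] WM.Lop_zero[of n] by simp
  qed
  then show ?thesis by auto
qed

lemma F_L0: "F (LV V 0 v) = LW V W 0 (F v)"
  by (simp add: F_LV phi_eq YWV_w_zero)

lemma F_T_div: "F (V.T_div k v) = W.T_div k (F v)"
proof -
  have "F (V.T v) = W.T (F v)" for v
    using F_LV[of "- 1" v] by (simp add: LV_minus_1 LW_minus_1 phi_eq)
  then have "F ((V.T ^^ k) v) = (W.T ^^ k) (F v)"
    by (induction k) simp_all
  then show ?thesis by (simp add: V.T_div_def W.T_div_def F_scale)
qed

lemma Y_vac: "Y V u (- 1 - int k) (vac V) = V.T_div k u"
proof (induction k arbitrary: u)
  case 0
  show ?case by (simp add: U.creation)
next
  case (Suc k)
  have "V.T_div k (V.T u) = Y V (LV V (- 1) u) (- 1 - int k) (vac V)"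
    by (simp add: Suc LV_minus_1)
  also have "\<dots> = vscale V (of_nat (Suc k)) (Y V u (- 1 - int (Suc k)) (vac V))"
  proof -
    have "- of_int (- 1 - int k) = (of_nat (Suc k) :: complex)" "- 1 - int k - 1 = - 1 - int (Suc k)"
      by simp_all
    then show ?thesis by (simp only: V.derivative)
  qed
  finally have "vscale V (of_nat (Suc k)) (V.T_div (Suc k) u)
    = vscale V (of_nat (Suc k)) (Y V u (- 1 - int (Suc k)) (vac V))"
    by (simp only: V.T_div_T)
  then have "V.T_div (Suc k) u = Y V u (- 1 - int (Suc k)) (vac V)"
    by (rule W.VV.scale_left_imp_eq[rotated]) (simp del: of_nat_Suc)
  then show ?case ..
qed

text \<open>Both sides are divided powers of L(-1) applied to F u, because F commutes with
  L(-1).\<close>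

lemma F_Y_vac: "F (Y V u n (vac V)) = YWV' (F u) n (vac V)"
proof (cases "n \<ge> 0")
  case True
  then show ?thesis by (simp add: U.creation_regular YWV_vac)
next
  case False
  then have "n = - 1 - int (nat (- n - 1))" by simp
  then show ?thesis using False
    by (metis F_T_div Y_vac YWV_vac)
qed

text \<open>The property is propagated from v to L(m)v for all u and n at once, because commuting
  u_n with L(m) replaces u by omega_j u.\<close>

lemma F_Y: "F (Y V u n v) = YW W u n (F v) + YWV' (F u) n v"
proof -
  let ?D = "{v. \<forall>u n. F (Y V u n v) = YW W u n (F v) + YWV' (F u) n v}"
  have "?D = UNIV"
  proof (rule generated)
    show "W.VV.subspace ?D"
      by (simp add: W.VV.subspace_def F_add F_scale V.Z_add V.Z_scale W.Z_add W.Z_scale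
          YWV_add YWV_scale W.VW.scale_right_distrib add_ac)
    show "vac V \<in> ?D" by (simp add: F_Y_vac)
    fix m v assume "v \<in> ?D"
    then have D: "F (Y V u n v) = YW W u n (F v) + YWV' (F u) n v" for u n by simp
    have "F (Y V u n (LV V m v)) = YW W u n (F (LV V m v)) + YWV' (F u) n (LV V m v)" for u n
    proof -
      \<comment> \<open>L(m) is the mode of omega with index m + 1, which is therefore the upper
        index of the binomials.\<close>
      let ?C = "\<lambda>j. of_int (m + 1) gchoose j :: complex"
      from eventually_conj[OF V.eventually_Z_eq_0[of "conf V" 0 u]
          eventually_conj[OF W.eventually_Z_eq_0[of "conf V" 0 "F u"] W.eventually_Z_eq_0[of u 0 "W.T w"]]]
      obtain J where J: "\<And>j. j \<ge> J \<Longrightarrow> Y V (conf V) (int j) u = 0"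
        "\<And>j. j \<ge> J \<Longrightarrow> YW W (conf V) (int j) (F u) = 0" "\<And>j. j \<ge> J \<Longrightarrow> YW W u (int j) (W.T w) = 0"
        unfolding eventually_sequentially by auto
      have comm_V: "Y V u n (LV V m v) = LV V m (Y V u n v)
        - (\<Sum>j<J. vscale V (?C j) (Y V (Y V (conf V) (int j) u) (m + 1 + n - int j) v))"
        unfolding LV_def by (subst V.commutator_formula[where N = J, symmetric]) (auto simp: J)
      have comm_W: "YW W u n (LW V W m (F v)) = LW V W m (YW W u n (F v))
        - (\<Sum>j<J. wscale W (?C j) (YW W (Y V (conf V) (int j) u) (m + 1 + n - int j) (F v)))"
        unfolding LW_def by (subst W.commutator_formula[where N = J, symmetric]) (auto simp: J)
      have comm_F: "YWV' (F u) n (LV V m v) = LW V W m (YWV' (F u) n v)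
        - (\<Sum>j<J. wscale W (?C j) (YWV' (YW W (conf V) (int j) (F u)) (m + 1 + n - int j) v))"
        unfolding LV_def LW_def add.commute[of "m + 1" n]
        by (subst YW_YWV_commutator[OF J(2), symmetric]) auto
      have comm_phi: "YW W u n (phi m v) = phi m (Y V u n v)
        - (\<Sum>j<J. wscale W (?C j) (YWV' (YWV' (W.T w) (int j) u) (m + 1 + n - int j) v))"
        unfolding phi_def by (subst YWV_YW_commutator[OF J(3), symmetric]) auto
      \<comment> \<open>This splits the correction from F(omega_j u) into the parts that
        \<open>comm_F\<close> and \<open>comm_phi\<close> require; the remaining part matches
        \<open>comm_W\<close>.\<close>
      have F_omega: "F (Y V (conf V) (int j) u) = YW W (conf V) (int j) (F u) + YWV' (W.T w) (int j) u" for j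
        using F_LV[of "int j - 1" u] by (simp add: LV_def LW_def phi_def)
      have "F (Y V u n (LV V m v)) = LW V W m (YW W u n (F v)) + LW V W m (YWV' (F u) n v) + phi m (Y V u n v)
        - ((\<Sum>j<J. wscale W (?C j) (YW W (Y V (conf V) (int j) u) (m + 1 + n - int j) (F v)))
         + (\<Sum>j<J. wscale W (?C j) (YWV' (YW W (conf V) (int j) (F u)) (m + 1 + n - int j) v))
         + (\<Sum>j<J. wscale W (?C j) (YWV' (YWV' (W.T w) (int j) u) (m + 1 + n - int j) v)))"
        unfolding comm_V F_diff F_LV F_sum F_scale D F_omega YWV_add_left
        by (simp only: L_linear W.VW.scale_right_distrib sum.distrib add.assoc)
      then show ?thesis
        by (simp add: F_LV W.Z_add comm_W comm_F comm_phi)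
    qed
    then show "LV V m v \<in> ?D" by blast
  qed
  then show ?thesis by blast
qed

end

section \<open>Generation of V by its vacuum, and the conclusion\<close>

theorem proposition4p5:
  fixes c :: complex
    and M0 :: "'m::ab_group_add vir_mod" and one :: 'm
    and V0 :: "'u::ab_group_add voa" and p :: "'m \<Rightarrow> 'u"
    and V :: "'v::ab_group_add voa" and q :: "'u \<Rightarrow> 'v"
    and W :: "('v, 'w::ab_group_add) voa_mod" and w1 w :: 'w
  assumes c: "\<not> minimal_central_charge c"
    and V0: "universal_virasoro_voa c M0 one V0 p"
    and V: "simple_quotient_voa c V0 V q"
    and W_module: "voa_module c V W"
    and W_verma: "verma_module c 1 (vir_of_mod c V W) w1"
    and dW: "dW W = LW V W 0"
    and w: "lowest_weight_vector 1 (vir_of_mod c V W) w"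
  shows "\<exists>F \<in> H1 V W. F (conf V) = LW V W (- 1) w"
proof -
  interpret voa_module c V W by (rule W_module)
  \<comment> \<open>The composite \<open>f\<close> of the two projections intertwines L(n) and is
    onto, so every vector of V is a combination of words in the L(n) applied to the vacuum.\<close>
  have generated: "S = UNIV" if S: "W.VV.subspace S" "vac V \<in> S" "\<And>n v. v \<in> S \<Longrightarrow> LV V n v \<in> S" for S
  proof -
    define f where "f x = q (p x)" for x
    have M0: "virasoro_rep M0" "surj (\<lambda>a. free_act M0 a one)"
      and p: "vir_hom M0 (vir_of_voa c V0) p" "surj p" and q: "voa_hom V0 V q" "surj q"
      and one: "p one = vac V0"
      using V0 V by (auto simp: universal_virasoro_voa_def verma_module_def vir_quotient_def simple_quotient_voa_def)
    interpret M0: virasoro_rep M0 by (rule M0)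
    have p_lin: "Vector_Spaces.linear (mscale M0) (vscale V0) p" and q_lin: "Vector_Spaces.linear (vscale V0) (vscale V) q"
      using p q by (auto simp: vir_hom_def voa_hom_def vir_of_voa_def)
    interpret p: Vector_Spaces.linear "mscale M0" "vscale V0" p by (rule p_lin)
    interpret q: Vector_Spaces.linear "vscale V0" "vscale V" q by (rule q_lin)
    have f_add: "f (x + y) = f x + f y" and f_scale: "f (mscale M0 k x) = vscale V k (f x)" for x y k
      by (simp_all add: f_def p.add p.scale q.add q.scale)
    have f_L: "f (Lop M0 n x) = LV V n (f x)" and f_C: "f (Cop M0 x) = vscale V c (f x)" for n x
      using p q by (simp_all add: f_def vir_hom_def voa_hom_def vir_of_voa_def LV_def q.scale)
    have "f (foldr (gen_act M0) u one) \<in> S" for u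
    proof (induction u)
      case Nil
      show ?case using one q S(2) by (simp add: f_def voa_hom_def)
    next
      case (Cons g u)
      then show ?case
        using S(3) W.VV.subspace_scale[OF S(1), of _ c] by (cases g) (simp_all add: f_L f_C)
    qed
    then have "f (free_act M0 a one) \<in> S" for a
      using W.VV.subspace_scale[OF S(1)] W.VV.subspace_add[OF S(1)]
      by (induction a rule: poly_mapping_add_induct)
        (simp_all add: M0.free_act_single M0.free_act_add f_add f_scale)
    moreover have "\<exists>a. v = f (free_act M0 a one)" for v
      unfolding f_def using M0(2) p(2) q(2) by (metis surjD)
    ultimately show ?thesis by (metis UNIV_eq_I)
  qed
  interpret lowest_weight_derivation c V W w w1
    by unfold_locales
      (use generated W_verma w in \<open>auto simp: lowest_weight_vector_def\<close>)
  have "Vector_Spaces.linear (vscale V) (wscale W) F"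
    by (intro Vector_Spaces.linear.intro module_hom.intro module_hom_axioms.intro
        W.VV.vector_space_axioms W.VW.vector_space_axioms W.VV.module_axioms W.VW.module_axioms F_add F_scale)
  then have "F \<in> H1 V W"
    by (auto simp: H1_def F_L0 F_Y dW)
  then show ?thesis using F_conf by blast
qed

end
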